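(* Assume $m>1$, $k>0$, $\mu>0$, where $m=\frac1{1-p}$ (that is, $p=\frac{m-1}{m}$) and $k=p\mu$. Then, for a given positive constant $c$, the equation $$V_t=(V^m)_{xx}+\mu V^m,\qquad t>0,\ x\in\mathbb{R},$$ has the following three types of weak traveling wave solutions $V(t,x)=V(\xi)$, $\xi=x-ct$ ($'=d/d\xi$): (A) There exists a family of weak traveling wave solutions (with quenching). Each solution $V(\xi)$ satisfies, with a finite $\xi_-$, the following: (A1) $\lim_{\xi\searrow\xi_-+0}V(\xi)=\lim_{\xi\to+\infty}V(\xi)=\lim_{\xi\to+\infty}V'(\xi)=0$, $\lim_{\xi\searrow\xi_-+0}V'(\xi)=+\infty$; (A2) $V(\xi)>0$ for $\xi\in(\xi_-,+\infty)$ and $V(\xi)=0$ for $\xi\in(-\infty,\xi_-]$; (A3) there exists a constant $\xi_0\in(\xi_-,+\infty)$ such that $V'(\xi)>0$ for $\xi\in(\xi_-,\xi_0)$, $V'(\xi_0)=0$, and $V'(\xi)<0$ for $\xi\in(\xi_0,+\infty)$. In addition, with positive constants $A_j$, $$V(\xi)\sim A_1(\xi-\xi_-)^{\frac1m},\quad V'(\xi)\sim A_2(\xi-\xi_-)^{-\frac{m-1}{m}}\quad\text{as }\xi\searrow\xi_-+0,\tag{$*$}$$ and, as $\xi\to+\infty$, $$V(\xi)\sim m^{-\frac1{m-1}}\left(\frac kc\right)^{-\frac1{m-1}}\xi^{-\frac1{m-1}},\quad V'(\xi)\sim-(m-1)^{-1}m^{-\frac1{m-1}}\left(\frac kc\right)^{-\frac1{m-1}}\xi^{-\frac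 m{m-1}}.$$ (B) There exists a family of weak traveling wave solutions (with quenching). Each solution $V(\xi)$ satisfies, with finite $\xi_-<\xi_+$, the following: (B1) $\lim_{\xi\searrow\xi_-+0}V(\xi)=\lim_{\xi\nearrow\xi_+-0}V(\xi)=0$, $\lim_{\xi\searrow\xi_-+0}V'(\xi)=+\infty$, $\lim_{\xi\nearrow\xi_+-0}V'(\xi)=-\infty$; (B2) $V(\xi)>0$ for $\xi\in(\xi_-,\xi_+)$ and $V(\xi)=0$ for $\xi\in(-\infty,\xi_-]\cup[\xi_+,+\infty)$; (B3) there exists a constant $\xi_0\in(\xi_-,\xi_+)$ such that $V'(\xi)>0$ for $\xi\in(\xi_-,\xi_0)$, $V'(\xi_0)=0$, and $V'(\xi)<0$ for $\xi\in(\xi_0,\xi_+)$. In addition, $( * )$ holds, and, with positive constants $A_j$, $$V(\xi)\sim A_3(\xi_+-\xi)^{\frac1m},\quad V'(\xi)\sim-A_4(\xi_+-\xi)^{-\frac{m-1}m}\quad\text{as }\xi\nearrow\xi_+-0.$$ (C) If $1<m<2$, then there exists a weak traveling wave solution (with quenching and singularity). The solution $V(\xi)$ satisfies, with finite $\xi_-<\xi_+$, (B2), (B3), and: (C1) $\lim_{\xi\searrow\xi_-+0}V(\xi)=\lim_{\xi\nearrow\xi_+-0}V(\xi)=0$, $\lim_{\xi\searrow\xi_-+0}V'(\xi)=+\infty$, $\lim_{\xi\nearrow\xi_+-0}V'(\xi)=0$. In addition, $( * )$ holds, and, with positive constants $A_j$, $$V(\xi)\sim A_5(\xi_+-\xi)^{\frac1{m-1}},\quad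 V'(\xi)\sim-A_6(\xi_+-\xi)^{-\frac{m-2}{m-1}}\quad\text{as }\xi\nearrow\xi_+-0.\tag{$**$}$$ If $m=2$, then there exists a weak traveling wave solution (with quenching and singularity). The solution $V(\xi)$ satisfies (B2), (B3), and: (C2) $\lim_{\xi\searrow\xi_-+0}V(\xi)=\lim_{\xi\nearrow\xi_+-0}V(\xi)=0$, $\lim_{\xi\searrow\xi_-+0}V'(\xi)=+\infty$, $\lim_{\xi\nearrow\xi_+-0}V'(\xi)=-C$ with $C>0$. In addition, $( * )$ and $( ** )$ hold. If $m>2$, then there exists a weak traveling wave solution (with quenching and singularity). The solution $V(\xi)$ satisfies (B1), (B2) and (B3). In addition, $( * )$ and $( ** )$ hold.
   Context: Traveling wave profile: with $V(t,x)=V(\xi)$, $\xi=x-ct$, the equation becomes the ODE $-cV'=(V^m)''+\mu V^m$, $'=d/d\xi$. A quasi traveling wave is a function $V(\xi)$ that solves this ODE on a finite or semi-infinite interval. It is with quenching if it is a solution on a finite interval $(\xi_-,\xi_+)$ (resp. semi-infinite interval $(\xi_-,+\infty)$), $C^2$ inside and continuous up to the finite endpoints (resp. endpoint), with $V\to0$ and $|V'|\to\infty$ at both finite endpoints (resp. at $\xi_-$). It is with quenching and singularity if, on a finite interval, $V\to0$ and $|V'|\to\infty$ at one endpoint, while at the other endpoint $V\to0$ and $V'\to-C$ with a constant $C>0$. The corresponding weak traveling wave solution (with quenching, defined for quasi traveling waves on a finite interval; resp. with quenching and singularity, on a finite or semi-infinite interval) is the function on $\mathbb{R}$ equal to the quasi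 traveling wave on its interval and to $0$ elsewhere. In (A) the term is applied with the interval $(\xi_-,+\infty)$, as written out in (A2). Notation: $f(\xi)\sim g(\xi)$ as $\xi\to a$ means $\lim_{\xi\to a}|f(\xi)/g(\xi)|=1$.
   Formalization: In (C), "with quenching and singularity" literally requires V'→-C with C>0 at one endpoint, which contradicts (C1) for 1<m<2 and (B1) for m>2; there the required limit of V' at ξ_+ is taken to be the stated one: 0 for 1<m<2, -∞ for m>2. *)

theory Defs
  imports "HOL-Analysis.Analysis"
begin

text \<open>
  Traveling wave profiles \<open>V(\<xi>)\<close>, \<open>\<xi> = x - c t\<close>, of the equation
  \<open>V_t = (V^m)_xx + \<mu> V^m\<close>. They satisfy \<open>- c V' = (V^m)'' + \<mu> V^m\<close>.
\<close>

text \<open>To be used on open sets only, where \<open>deriv\<close> is the two-sided derivative.\<close>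

definition C2_on :: "(real \<Rightarrow> real) \<Rightarrow> real set \<Rightarrow> bool" where
  "C2_on f S \<longleftrightarrow>
     (\<forall>x\<in>S. f differentiable (at x) \<and> deriv f differentiable (at x)) \<and>
     continuous_on S (deriv (deriv f))"

text \<open>
  Since \<open>m\<close> need not be an integer, \<open>V^m\<close> is only meaningful for \<open>V \<ge> 0\<close>.
  Its differentiability is required because \<open>deriv\<close> is a total operator.
\<close>

definition quasi_tw_on :: "real \<Rightarrow> real \<Rightarrow> real \<Rightarrow> (real \<Rightarrow> real) \<Rightarrow> real set \<Rightarrow> bool" where
  "quasi_tw_on m \<mu> c V S \<longleftrightarrow>
     C2_on V S \<and>
     (\<forall>\<xi>\<in>S. 0 \<le> V \<xi> \<and>
        (\<lambda>x. V x powr m) differentiable (at \<xi>) \<and>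
        deriv (\<lambda>x. V x powr m) differentiable (at \<xi>) \<and>
        - c * deriv V \<xi> = deriv (deriv (\<lambda>x. V x powr m)) \<xi> + \<mu> * V \<xi> powr m)"

definition quenches :: "(real \<Rightarrow> real) \<Rightarrow> real filter \<Rightarrow> bool" where
  "quenches V F \<longleftrightarrow> (V \<longlongrightarrow> 0) F \<and> filterlim (\<lambda>\<xi>. \<bar>deriv V \<xi>\<bar>) at_top F"

definition quasi_tw_quenching ::
  "real \<Rightarrow> real \<Rightarrow> real \<Rightarrow> real \<Rightarrow> real \<Rightarrow> (real \<Rightarrow> real) \<Rightarrow> bool" where
  "quasi_tw_quenching m \<mu> c \<xi>m \<xi>p V \<longleftrightarrow>
     \<xi>m < \<xi>p \<and> quasi_tw_on m \<mu> c V {\<xi>m<..<\<xi>p} \<and> continuous_on {\<xi>m..\<xi>p} V \<and>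
     quenches V (at_right \<xi>m) \<and> quenches V (at_left \<xi>p)"

definition quasi_tw_quenching_semi ::
  "real \<Rightarrow> real \<Rightarrow> real \<Rightarrow> real \<Rightarrow> (real \<Rightarrow> real) \<Rightarrow> bool" where
  "quasi_tw_quenching_semi m \<mu> c \<xi>m V \<longleftrightarrow>
     quasi_tw_on m \<mu> c V {\<xi>m<..} \<and> continuous_on {\<xi>m..} V \<and>
     quenches V (at_right \<xi>m)"

text \<open>
  At the singular endpoint \<open>V \<rightarrow> 0\<close> and \<open>V'\<close> tends to \<open>L\<close>. The generic notion has
  \<open>L = nhds (-C)\<close> with \<open>C > 0\<close>; this occurs for \<open>m = 2\<close>. The term is also used for
  \<open>1 < m < 2\<close>, where \<open>V' \<rightarrow> 0\<close> (so \<open>L = nhds 0\<close>), and for \<open>m > 2\<close>, where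
  \<open>V' \<rightarrow> -\<infinity>\<close> (so \<open>L = at_bot\<close>). Hence \<open>L\<close> is a parameter.
\<close>

definition singular_end :: "real filter \<Rightarrow> (real \<Rightarrow> real) \<Rightarrow> real filter \<Rightarrow> bool" where
  "singular_end L V F \<longleftrightarrow> (V \<longlongrightarrow> 0) F \<and> filterlim (deriv V) L F"

definition quasi_tw_quenching_singularity ::
  "real filter \<Rightarrow> real \<Rightarrow> real \<Rightarrow> real \<Rightarrow> real \<Rightarrow> real \<Rightarrow> (real \<Rightarrow> real) \<Rightarrow> bool" where
  "quasi_tw_quenching_singularity L m \<mu> c \<xi>m \<xi>p V \<longleftrightarrow>
     \<xi>m < \<xi>p \<and> quasi_tw_on m \<mu> c V {\<xi>m<..<\<xi>p} \<and> continuous_on {\<xi>m..\<xi>p} V \<and>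
     (quenches V (at_right \<xi>m) \<and> singular_end L V (at_left \<xi>p) \<or>
      quenches V (at_left \<xi>p) \<and> singular_end L V (at_right \<xi>m))"

definition zero_extension :: "(real \<Rightarrow> real) \<Rightarrow> real set \<Rightarrow> real \<Rightarrow> real" where
  "zero_extension V S = (\<lambda>\<xi>. if \<xi> \<in> S then V \<xi> else 0)"

definition weak_tw_quenching ::
  "real \<Rightarrow> real \<Rightarrow> real \<Rightarrow> real \<Rightarrow> real \<Rightarrow> (real \<Rightarrow> real) \<Rightarrow> bool" where
  "weak_tw_quenching m \<mu> c \<xi>m \<xi>p W \<longleftrightarrow>
     (\<exists>V. quasi_tw_quenching m \<mu> c \<xi>m \<xi>p V \<and> W = zero_extension V {\<xi>m<..<\<xi>p})"

definition weak_tw_quenching_semi ::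
  "real \<Rightarrow> real \<Rightarrow> real \<Rightarrow> real \<Rightarrow> (real \<Rightarrow> real) \<Rightarrow> bool" where
  "weak_tw_quenching_semi m \<mu> c \<xi>m W \<longleftrightarrow>
     (\<exists>V. quasi_tw_quenching_semi m \<mu> c \<xi>m V \<and> W = zero_extension V {\<xi>m<..})"

definition weak_tw_quenching_singularity ::
  "real filter \<Rightarrow> real \<Rightarrow> real \<Rightarrow> real \<Rightarrow> real \<Rightarrow> real \<Rightarrow> (real \<Rightarrow> real) \<Rightarrow> bool" where
  "weak_tw_quenching_singularity L m \<mu> c \<xi>m \<xi>p W \<longleftrightarrow>
     (\<exists>V. quasi_tw_quenching_singularity L m \<mu> c \<xi>m \<xi>p V \<and>
          W = zero_extension V {\<xi>m<..<\<xi>p})"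

text \<open>
  Weaker than \<open>asymp_equiv\<close> from the library: the quotient is taken in absolute value.
\<close>

definition sim_abs :: "(real \<Rightarrow> real) \<Rightarrow> (real \<Rightarrow> real) \<Rightarrow> real filter \<Rightarrow> bool" where
  "sim_abs f g F \<longleftrightarrow> ((\<lambda>\<xi>. \<bar>f \<xi> / g \<xi>\<bar>) \<longlongrightarrow> 1) F"

definition single_peak_on :: "(real \<Rightarrow> real) \<Rightarrow> real set \<Rightarrow> bool" where
  "single_peak_on V S \<longleftrightarrow>
     (\<exists>\<xi>0\<in>S. (\<forall>\<xi>\<in>S. \<xi> < \<xi>0 \<longrightarrow> deriv V \<xi> > 0) \<and> deriv V \<xi>0 = 0 \<and>
              (\<forall>\<xi>\<in>S. \<xi>0 < \<xi> \<longrightarrow> deriv V \<xi> < 0))"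

definition positive_exactly_on :: "(real \<Rightarrow> real) \<Rightarrow> real set \<Rightarrow> bool" where
  "positive_exactly_on V S \<longleftrightarrow> (\<forall>\<xi>\<in>S. V \<xi> > 0) \<and> (\<forall>\<xi>. \<xi> \<notin> S \<longrightarrow> V \<xi> = 0)"

definition left_end_asymp :: "real \<Rightarrow> real \<Rightarrow> (real \<Rightarrow> real) \<Rightarrow> bool" where
  "left_end_asymp m \<xi>m V \<longleftrightarrow>
     (\<exists>A1>0. \<exists>A2>0.
        sim_abs V (\<lambda>\<xi>. A1 * (\<xi> - \<xi>m) powr (1 / m)) (at_right \<xi>m) \<and>
        sim_abs (deriv V) (\<lambda>\<xi>. A2 * (\<xi> - \<xi>m) powr (- ((m - 1) / m))) (at_right \<xi>m))"

definition singular_end_asymp :: "real \<Rightarrow> real \<Rightarrow> (real \<Rightarrow> real) \<Rightarrow> bool" where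
  "singular_end_asymp m \<xi>p V \<longleftrightarrow>
     (\<exists>A5>0. \<exists>A6>0.
        sim_abs V (\<lambda>\<xi>. A5 * (\<xi>p - \<xi>) powr (1 / (m - 1))) (at_left \<xi>p) \<and>
        sim_abs (deriv V) (\<lambda>\<xi>. - A6 * (\<xi>p - \<xi>) powr (- ((m - 2) / (m - 1)))) (at_left \<xi>p))"

text \<open>
  A family of profiles means a one-parameter family. Every profile trivially generates a
  family by translation, so distinct parameters are required to give profiles that are not
  translates of each other.
\<close>

definition tw_family :: "((real \<Rightarrow> real) \<Rightarrow> bool) \<Rightarrow> bool" where
  "tw_family P \<longleftrightarrow>
     (\<exists>V :: real \<Rightarrow> real \<Rightarrow> real. (\<forall>s. P (V s)) \<and>
        (\<forall>s t h. V s = (\<lambda>\<xi>. V t (\<xi> + h)) \<longrightarrow> s = t))"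

end

theory Submission
  imports Defs
begin

text \<open>
  In the time \<open>t\<close> with \<open>d\<xi> = m V^(m-1) dt\<close> the profile equation becomes the damped nonlinear
  oscillator \<open>V'' + c V' + m \<mu> V^(2m-1) = 0\<close>, whose velocity \<open>p = dV/dt\<close> is the \<open>\<xi>\<close>-derivative of
  \<open>V^m\<close>. Start it at rest from a peak of height \<open>M\<close>. Backwards it reaches \<open>V = 0\<close> with positive
  speed (quenching). Forwards, for large \<open>M\<close> the orbit reaches \<open>V = 0\<close> with negative speed (B);
  for small \<open>M\<close> it is trapped in the sector \<open>p \<ge> - (c/2) V\<close> and creeps into the origin along the
  slow direction, \<open>p / V^(2m-1) \<rightarrow> - m \<mu> / c\<close> (A). Both behaviours are open in \<open>M\<close>, so some height
  in between has neither; that orbit enters the origin along the fast direction,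
  \<open>p / V \<rightarrow> - c\<close> (C). In each case \<open>W' W^(a-1)\<close> has a nonzero limit at the end, with \<open>a\<close> equal to
  \<open>m\<close> (quenching), \<open>1 - m\<close> (A) or \<open>m - 1\<close> (C), and L'Hopital's rule for \<open>W^a\<close> gives the asymptotics.
\<close>

section \<open>Lipschitz differential equations\<close>

text \<open>In the variable \<xi> the equation degenerates at \<open>V = 0\<close>, exactly where
  the profiles end. In the time \<open>t\<close> the force has exponent
  \<open>2 * m - 1 > 1\<close>, so after truncation the vector field is globally Lipschitz: orbits
  exist for all times, run through \<open>V = 0\<close>, and depend continuously on the peak height.
  The difficulty moves to the origin, a degenerate equilibrium whose linear part has the eigenvalues
  0 (slow direction) and \<open>- c\<close> (fast direction). The approach to it is controlled by
  scalar differential inequalities for \<open>p / V\<close> and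
  \<open>p / V powr (2 * m - 1)\<close>. Two quantities decide the fate of an orbit. The sum
  \<open>p + c * V\<close> never increases, and an orbit reaches \<open>V = 0\<close> at a positive
  time iff this sum becomes negative at some time \<ge> 0. The slope \<open>c / 2\<close> is a
  convenient value strictly between the two limiting slopes 0 and \<open>c\<close>. The length of
  the profile is the integral of \<open>m * V powr (m - 1)\<close> over time. Exponential decay of
  \<open>V\<close> makes it converge, which gives a finite end in (C); along the slow direction it
  diverges, which gives the half-line in (A).\<close>

lemma continuous_antiderivative:
  fixes f :: "real \<Rightarrow> 'a::euclidean_space"
  assumes "continuous_on UNIV f"
  obtains F where "F 0 = 0" "\<And>t. (F has_vector_derivative f t) (at t)"
proof -
  have "isCont f x" for x
    using assms continuous_on_eq_continuous_at[of UNIV f] by auto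
  then obtain G where G: "\<And>t::real. (G has_vector_derivative f t) (at t)"
    using einterval_antiderivative[of "-\<infinity>" "\<infinity>" f] by auto
  show thesis
    by (rule that[of "\<lambda>t. G t - G 0"]) (auto intro!: derivative_eq_intros G)
qed

text \<open>Integration gains a factor \<open>1 / K\<close> in the exponential weight; this factor
  later beats the Lipschitz constant. For positive times it is the mean value inequality against
  \<open>A / K * exp (K * t)\<close>, and negative times follow by reflection.\<close>

lemma antiderivative_exp_bound:
  fixes f :: "real \<Rightarrow> 'a::euclidean_space"
  assumes F0: "F 0 = 0" and F': "\<And>t. (F has_vector_derivative f t) (at t)"
    and f: "\<And>t. norm (f t) \<le> A * exp (K * \<bar>t\<bar>)" and K: "K > 0"
  shows "norm (F t) \<le> A / K * exp (K * \<bar>t\<bar>)"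
proof -
  have A: "A \<ge> 0" using f[of 0] norm_ge_zero[of "f 0"] by (simp del: norm_ge_zero)
  have *: "norm (F t) \<le> A / K * exp (K * t)"
    if t: "t > 0" and F0: "F 0 = 0" and F': "\<And>t. (F has_vector_derivative f t) (at t)"
      and f: "\<And>t. norm (f t) \<le> A * exp (K * \<bar>t\<bar>)" for t F and f :: "real \<Rightarrow> 'a"
  proof -
    have "norm (F t - F 0) \<le> A / K * exp (K * t) - A / K * exp (K * 0)"
    proof (rule differentiable_bound_general[OF t])
      show "continuous_on {0..t} F"
        using F' by (blast intro: continuous_at_imp_continuous_on has_vector_derivative_continuous)
      show "((\<lambda>t. A / K * exp (K * t)) has_vector_derivative A * exp (K * x)) (at x)" for x
        using K by (auto intro!: derivative_eq_intros
            simp flip: has_real_derivative_iff_has_vector_derivative)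
      show "norm (f x) \<le> A * exp (K * x)" if "0 < x" for x
        using f[of x] that by simp
    qed (use K in \<open>auto intro!: continuous_intros F'\<close>)
    moreover have "A / K \<ge> 0" using A K by simp
    ultimately show ?thesis using F0 by simp
  qed
  consider "t = 0" | "t > 0" | "t < 0" by linarith
  then show ?thesis
  proof cases
    case 1 then show ?thesis using F0 A K by simp
  next
    case 2 then show ?thesis using *[OF 2 F0 F' f] by simp
  next
    case 3
    have "((\<lambda>s. F (- s)) has_vector_derivative - f (- s)) (at s)" for s
      using vector_diff_chain_at[of uminus "-1" s F "f (- s)"] F'[of "- s"]
      by (auto simp: o_def has_vector_derivative_minus intro!: derivative_eq_intros)
    from *[of "- t" "\<lambda>s. F (- s)", OF _ _ this] show ?thesis
      using 3 F0 f by (auto simp: abs_minus_cancel) (metis abs_minus_cancel)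
  qed
qed

text \<open>In the norm weighted by \<open>exp (- K * \<bar>t\<bar>)\<close>, with \<open>K\<close> large compared to the Lipschitz
  constant, the Picard operator is a contraction on the whole line at once.\<close>

lemma lipschitz_ode_exists:
  fixes F :: "'a::euclidean_space \<Rightarrow> 'a"
  assumes "L-lipschitz_on UNIV F"
  obtains x where "x 0 = x0" "\<And>t. (x has_vector_derivative F (x t)) (at t)"
proof -
  have L0: "L \<ge> 0" and L: "\<And>u v. norm (F u - F v) \<le> L * norm (u - v)"
    using assms by (auto simp: lipschitz_on_def dist_norm)
  have contF: "continuous_on UNIV F"
    using assms lipschitz_on_continuous_on by blast
  \<comment> \<open>Twice \<open>L\<close> brings the contraction factor \<open>L / K\<close> down
    to 1/2; the summand 1 keeps \<open>K\<close> positive when \<open>L = 0\<close>.\<close>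
  define K where "K = 2 * L + 1"
  have K: "K > 0" "L / K \<le> 1 / 2" using L0 by (auto simp: K_def field_simps)
  \<comment> \<open>The unknown \<open>y\<close> is the weighted curve, a bounded function; the
    weight is removed before \<open>F\<close> is applied and put back in \<open>T\<close>.\<close>
  define h where "h y s = F (exp (K * \<bar>s\<bar>) *\<^sub>R apply_bcontfun y s)"
    for y :: "real \<Rightarrow>\<^sub>C 'a" and s
  have conth: "continuous_on UNIV (h y)" for y
    unfolding h_def
    by (intro continuous_on_compose2[OF contF]) (auto intro!: continuous_intros)
  have "\<exists>G. G 0 = 0 \<and> (\<forall>t. (G has_vector_derivative h y t) (at t))" for y
    using continuous_antiderivative[OF conth[of y]] by metis
  then obtain \<Phi> where \<Phi>0: "\<And>y. \<Phi> y 0 = 0"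
    and \<Phi>: "\<And>y t. (\<Phi> y has_vector_derivative h y t) (at t)"
    by metis
  define T where "T y t = exp (- (K * \<bar>t\<bar>)) *\<^sub>R (x0 + \<Phi> y t)" for y t
  have T: "T y \<in> bcontfun" for y
  proof -
    have "continuous_on UNIV (\<Phi> y)"
      using \<Phi> by (blast intro: continuous_at_imp_continuous_on has_vector_derivative_continuous)
    then have "continuous_on UNIV (T y)"
      unfolding T_def by (auto intro!: continuous_intros)
    moreover have "bounded (range (T y))"
    proof -
      obtain B where B: "\<And>t. norm (apply_bcontfun y t) \<le> B" "B \<ge> 0"
      proof -
        have "bounded (range (apply_bcontfun y))" by simp
        then obtain B where "\<And>t. norm (apply_bcontfun y t) \<le> B"
          by (auto simp: bounded_iff)
        moreover from this[of 0] have "B \<ge> 0" using norm_ge_zero order_trans by blast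
        ultimately show thesis using that by blast
      qed
      have hb: "norm (h y s) \<le> (norm (F 0) + L * B) * exp (K * \<bar>s\<bar>)" for s
      proof -
        have "norm (h y s) \<le> norm (F 0) + norm (h y s - F 0)"
          by (metis norm_triangle_sub)
        also have "norm (h y s - F 0) \<le> L * (exp (K * \<bar>s\<bar>) * norm (apply_bcontfun y s))"
          using L[of "exp (K * \<bar>s\<bar>) *\<^sub>R apply_bcontfun y s" 0] by (simp add: h_def)
        also have "\<dots> \<le> L * (exp (K * \<bar>s\<bar>) * B)"
          using B L0 by (intro mult_left_mono) auto
        also have "norm (F 0) \<le> norm (F 0) * exp (K * \<bar>s\<bar>)"
          using K by (intro mult_right_le_one_le[THEN order_trans] | simp add: mult_le_cancel_left1)+
        finally show ?thesis by (simp add: algebra_simps)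
      qed
      have "norm (T y t) \<le> norm x0 + (norm (F 0) + L * B) / K" for t
      proof -
        have "norm (T y t) \<le> exp (- (K * \<bar>t\<bar>)) * (norm x0 + norm (\<Phi> y t))"
          by (auto simp: T_def intro!: norm_triangle_ineq)
        also have "\<dots> \<le> exp (- (K * \<bar>t\<bar>)) * (norm x0 + (norm (F 0) + L * B) / K * exp (K * \<bar>t\<bar>))"
          using antiderivative_exp_bound[OF \<Phi>0 \<Phi> hb K(1)]
          by (intro mult_left_mono add_left_mono) auto
        also have "\<dots> = exp (- (K * \<bar>t\<bar>)) * norm x0 + (norm (F 0) + L * B) / K"
          by (simp add: algebra_simps exp_minus)
        also have "exp (- (K * \<bar>t\<bar>)) * norm x0 \<le> norm x0"
          using K by (intro mult_left_le_one_le) auto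
        finally show ?thesis by simp
      qed
      then show ?thesis by (auto simp: bounded_iff)
    qed
    ultimately show ?thesis by (simp add: bcontfun_def)
  qed
  have "dist (Bcontfun (T y)) (Bcontfun (T z)) \<le> 1 / 2 * dist y z" for y z
  proof (rule dist_bound)
    fix t
    have "norm (h y s - h z s) \<le> (L * dist y z) * exp (K * \<bar>s\<bar>)" for s
    proof -
      have "norm (h y s - h z s)
          \<le> L * (exp (K * \<bar>s\<bar>) * norm (apply_bcontfun y s - apply_bcontfun z s))"
        using L[of "exp (K * \<bar>s\<bar>) *\<^sub>R apply_bcontfun y s" "exp (K * \<bar>s\<bar>) *\<^sub>R apply_bcontfun z s"]
        by (simp add: h_def flip: scaleR_diff_right)
      also have "\<dots> \<le> L * (exp (K * \<bar>s\<bar>) * dist y z)"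
        using L0 dist_bounded[of y s z] by (intro mult_left_mono) (auto simp: dist_norm)
      finally show ?thesis by (simp add: mult_ac)
    qed
    from antiderivative_exp_bound[of "\<lambda>t. \<Phi> y t - \<Phi> z t", OF _ _ this K(1)]
    have b: "norm (\<Phi> y t - \<Phi> z t) \<le> L * dist y z / K * exp (K * \<bar>t\<bar>)"
      by (auto simp: \<Phi>0 intro!: derivative_eq_intros \<Phi>)
    have "dist (T y t) (T z t) = exp (- (K * \<bar>t\<bar>)) * norm (\<Phi> y t - \<Phi> z t)"
      by (simp add: T_def dist_norm flip: scaleR_diff_right)
    also have "\<dots> \<le> exp (- (K * \<bar>t\<bar>)) * (L * dist y z / K * exp (K * \<bar>t\<bar>))"
      using b by (intro mult_left_mono) auto
    also have "\<dots> = L / K * dist y z" by (simp add: exp_minus)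
    also have "\<dots> \<le> 1 / 2 * dist y z" using K by (intro mult_right_mono) auto
    finally show "dist (apply_bcontfun (Bcontfun (T y)) t) (apply_bcontfun (Bcontfun (T z)) t)
        \<le> 1 / 2 * dist y z"
      by (simp add: Bcontfun_inverse[OF T])
  qed
  then obtain y where y: "Bcontfun (T y) = y"
    using banach_fix_type[of "1/2" "\<lambda>y. Bcontfun (T y)"] by auto
  then have "apply_bcontfun y t = T y t" for t
    using Bcontfun_inverse[OF T[of y]] by simp
  then have hy: "h y t = F (x0 + \<Phi> y t)" for t
    by (simp add: h_def T_def exp_minus)
  show thesis
  proof (rule that[of "\<lambda>t. x0 + \<Phi> y t"])
    show "((\<lambda>t. x0 + \<Phi> y t) has_vector_derivative F (x0 + \<Phi> y t)) (at t)" for t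
      unfolding hy[symmetric] by (auto intro!: derivative_eq_intros \<Phi>)
  qed (simp add: \<Phi>0)
qed

text \<open>Gronwall's argument for the squared distance \<open>D\<close>, which satisfies
  \<open>D' \<le> 2 * L * D\<close>. Unlike the distance itself, \<open>D\<close> is differentiable
  also where the curves meet.\<close>

lemma lipschitz_ode_dependence:
  fixes F :: "'a::real_inner \<Rightarrow> 'a"
  assumes "L-lipschitz_on UNIV F"
    and x: "\<And>t. (x has_vector_derivative F (x t)) (at t)"
    and y: "\<And>t. (y has_vector_derivative F (y t)) (at t)"
    and t: "t \<ge> 0"
  shows "dist (x t) (y t) \<le> exp (L * t) * dist (x 0) (y 0)"
proof -
  define D where "D t = (x t - y t) \<bullet> (x t - y t)" for t
  have D: "(D has_real_derivative 2 * ((x s - y s) \<bullet> (F (x s) - F (y s)))) (at s)" for s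
    unfolding D_def has_field_derivative_def
    by (rule derivative_eq_intros x[unfolded has_vector_derivative_def]
        y[unfolded has_vector_derivative_def] refl)+
      (auto simp: fun_eq_iff algebra_simps inner_commute)
  have bound: "2 * ((x s - y s) \<bullet> (F (x s) - F (y s))) \<le> 2 * L * D s" for s
  proof -
    have "(x s - y s) \<bullet> (F (x s) - F (y s)) \<le> norm (x s - y s) * norm (F (x s) - F (y s))"
      by (rule norm_cauchy_schwarz)
    also have "\<dots> \<le> norm (x s - y s) * (L * norm (x s - y s))"
      using assms(1) by (intro mult_left_mono) (auto simp: lipschitz_on_def dist_norm)
    finally show ?thesis
      by (simp add: D_def power2_norm_eq_inner[symmetric] power2_eq_square mult_ac)
  qed
  have "D t * exp (- 2 * L * t) \<le> D 0 * exp (- 2 * L * 0)"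
  proof (rule DERIV_nonpos_imp_nonincreasing[OF t])
    fix s
    have "((\<lambda>t. D t * exp (- 2 * L * t)) has_real_derivative
        (2 * ((x s - y s) \<bullet> (F (x s) - F (y s))) - 2 * L * D s) * exp (- 2 * L * s)) (at s)"
      by (auto intro!: derivative_eq_intros D simp: algebra_simps)
    then show "\<exists>l. ((\<lambda>t. D t * exp (- 2 * L * t)) has_real_derivative l) (at s) \<and> l \<le> 0"
      using bound[of s] by (intro exI conjI) (auto simp: mult_le_0_iff)
  qed
  then have "D t \<le> D 0 * exp (2 * L * t)"
    by (simp add: exp_minus field_simps)
  then have "(dist (x t) (y t))\<^sup>2 \<le> (exp (L * t) * dist (x 0) (y 0))\<^sup>2"
    by (simp add: D_def power_mult_distrib dist_norm power2_norm_eq_inner mult_ac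
        flip: exp_of_nat_mult)
  then show ?thesis by (rule power2_le_imp_le) auto
qed

section \<open>The damped oscillator\<close>

lemma powr_inverse_powr: "0 < x \<Longrightarrow> a \<noteq> 0 \<Longrightarrow> (x powr (1 / a)) powr a = x" for x a :: real
  by (simp add: powr_powr)

lemma powr_lipschitz:
  fixes x y a R :: real
  assumes "a \<ge> 1" "0 \<le> x" "x \<le> R" "0 \<le> y" "y \<le> R"
  shows "\<bar>x powr a - y powr a\<bar> \<le> a * R powr (a - 1) * \<bar>x - y\<bar>"
proof -
  have *: "\<bar>y powr a - x powr a\<bar> \<le> a * R powr (a - 1) * \<bar>y - x\<bar>"
    if "0 \<le> x" "x < y" "y \<le> R" for x y
  proof -
    have "\<exists>l z. x < z \<and> z < y \<and> ((\<lambda>x. x powr a) has_real_derivative l) (at z)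
        \<and> y powr a - x powr a = (y - x) * l"
    proof (rule MVT)
      show "continuous_on {x..y} (\<lambda>x. x powr a)"
        using assms(1) that by (intro continuous_on_powr') (auto intro!: continuous_intros)
      show "(\<lambda>x. x powr a) differentiable (at z)" if "x < z" for z
        using has_real_derivative_powr[of z a] \<open>0 \<le> x\<close> that
        by (auto simp: real_differentiable_def)
    qed (use that in auto)
    then obtain l z where z: "x < z" "z < y" "((\<lambda>x. x powr a) has_real_derivative l) (at z)"
      and eq: "y powr a - x powr a = (y - x) * l" by blast
    have l: "l = a * z powr (a - 1)"
      using DERIV_unique[OF z(3) has_real_derivative_powr[of z a]] z that by auto
    have "z powr (a - 1) \<le> R powr (a - 1)"
      using z that assms(1) by (intro powr_mono2) auto
    then have "0 \<le> l" "l \<le> a * R powr (a - 1)"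
      using assms(1) z that unfolding l by (auto intro!: mult_left_mono)
    then show ?thesis
      unfolding eq using that by (simp add: abs_mult mult.commute mult_right_mono)
  qed
  show ?thesis
    using *[of x y] *[of y x] assms by (cases x y rule: linorder_cases) (auto simp: abs_minus_commute)
qed

text \<open>For given \<open>e\<close>, as soon as \<open>h\<close> is below
  \<open>\<kappa> * e / 2\<close>, the excess \<open>y - e / 2\<close> is bounded above by a
  multiple of \<open>exp (- \<kappa> * t)\<close>. Both limits along the slow direction are obtained
  from this comparison.\<close>

lemma linear_decay:
  fixes y h :: "real \<Rightarrow> real"
  assumes "\<kappa> > 0"
    and y': "\<forall>\<^sub>F t in at_top. (y has_real_derivative y' t) (at t) \<and> y' t \<le> - \<kappa> * y t + h t"
    and pos: "\<forall>\<^sub>F t in at_top. 0 \<le> y t" and h: "(h \<longlongrightarrow> 0) at_top"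
  shows "(y \<longlongrightarrow> 0) at_top"
proof (rule order_tendstoI)
  show "\<forall>\<^sub>F t in at_top. l < y t" if "l < 0" for l
    using pos by eventually_elim (use that in auto)
  fix e :: real assume e: "0 < e"
  have "\<forall>\<^sub>F t in at_top. h t < \<kappa> * e / 2"
    using order_tendstoD(2)[OF h, of "\<kappa> * e / 2"] assms(1) e by simp
  with y' have "\<forall>\<^sub>F t in at_top. (y has_real_derivative y' t) (at t) \<and> y' t \<le> - \<kappa> * y t + \<kappa> * e / 2"
    by eventually_elim auto
  then obtain T where T: "\<And>t. t \<ge> T \<Longrightarrow> (y has_real_derivative y' t) (at t)"
      "\<And>t. t \<ge> T \<Longrightarrow> y' t \<le> - \<kappa> * y t + \<kappa> * e / 2"
    by (auto simp: eventually_at_top_linorder)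
  define f where "f t = (y t - e / 2) * exp (\<kappa> * t)" for t
  have f: "f t \<le> f T" if "t \<ge> T" for t
  proof (rule DERIV_nonpos_imp_nonincreasing[OF that])
    fix s assume s: "T \<le> s"
    have "(f has_real_derivative (y' s + \<kappa> * y s - \<kappa> * e / 2) * exp (\<kappa> * s)) (at s)"
      unfolding f_def by (auto intro!: derivative_eq_intros T s simp: algebra_simps)
    then show "\<exists>l. (f has_real_derivative l) (at s) \<and> l \<le> 0"
      using T(2)[OF s] by (intro exI conjI) (auto simp: mult_le_0_iff)
  qed
  have "((\<lambda>t. f T * exp (- (\<kappa> * t))) \<longlongrightarrow> f T * 0) at_top"
    using assms(1)
    by (intro tendsto_intros filterlim_compose[OF exp_at_bot]
        filterlim_compose[OF filterlim_uminus_at_bot_at_top]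
        filterlim_tendsto_pos_mult_at_top[OF tendsto_const] filterlim_ident)
  then have "\<forall>\<^sub>F t in at_top. f T * exp (- (\<kappa> * t)) < e / 2"
    using e by (intro order_tendstoD(2)) auto
  then show "\<forall>\<^sub>F t in at_top. y t < e"
    using eventually_ge_at_top[of T]
  proof eventually_elim
    case (elim t)
    have "y t = e / 2 + f t * exp (- (\<kappa> * t))"
      by (simp add: f_def exp_minus field_simps)
    also have "f t * exp (- (\<kappa> * t)) \<le> f T * exp (- (\<kappa> * t))"
      using f elim by (intro mult_right_mono) auto
    finally show ?case using elim by linarith
  qed
qed

section \<open>The truncated oscillator and its flow\<close>

locale wave_params =
  fixes m \<mu> c :: real
  assumes m: "m > 1" and \<mu>: "\<mu> > 0" and c: "c > 0"
begin

text \<open>The truncation makes the restoring force globally Lipschitz; orbits starting at a peak of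
  height at most \<open>R\<close> solve the original equation as long as they are nonnegative.\<close>

definition G :: "real \<Rightarrow> real \<Rightarrow> real" where
  "G R v = m * \<mu> * min R (max 0 v) powr (2 * m - 1)"

lemma G_nonneg: "0 \<le> G R v"
  using m \<mu> by (simp add: G_def)

lemma G_eq: "0 \<le> v \<Longrightarrow> v \<le> R \<Longrightarrow> G R v = m * \<mu> * v powr (2 * m - 1)"
  by (simp add: G_def max_def min_def)

lemma G_pos: "0 < R \<Longrightarrow> 0 < v \<Longrightarrow> 0 < G R v"
  using m \<mu> by (simp add: G_def min_def)

lemma G_mono: "u \<le> v \<Longrightarrow> 0 \<le> R \<Longrightarrow> G R u \<le> G R v"
  unfolding G_def using m \<mu> by (intro mult_left_mono powr_mono2) auto

lemma G_lipschitz: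
  assumes "0 \<le> R"
  obtains l where "0 \<le> l" "\<And>u v. \<bar>G R u - G R v\<bar> \<le> l * \<bar>u - v\<bar>"
proof
  let ?l = "m * \<mu> * ((2 * m - 1) * R powr (2 * m - 1 - 1))"
  show "0 \<le> ?l" using m \<mu> by simp
  fix u v
  let ?u = "min R (max 0 u)" and ?v = "min R (max 0 v)"
  have "\<bar>G R u - G R v\<bar> = m * \<mu> * \<bar>?u powr (2 * m - 1) - ?v powr (2 * m - 1)\<bar>"
    using m \<mu> unfolding G_def right_diff_distrib[symmetric] abs_mult by simp
  also have "\<dots> \<le> m * \<mu> * ((2 * m - 1) * R powr (2 * m - 1 - 1) * \<bar>?u - ?v\<bar>)"
    using m \<mu> assms by (intro mult_left_mono powr_lipschitz) auto
  also have "\<dots> = ?l * \<bar>?u - ?v\<bar>" by simp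
  also have "\<dots> \<le> ?l * \<bar>u - v\<bar>"
    using \<open>0 \<le> ?l\<close> by (intro mult_left_mono) auto
  finally show "\<bar>G R u - G R v\<bar> \<le> ?l * \<bar>u - v\<bar>" .
qed

definition osc :: "real \<Rightarrow> (real \<Rightarrow> real) \<Rightarrow> (real \<Rightarrow> real) \<Rightarrow> bool" where
  "osc R V p \<longleftrightarrow> (\<forall>t. (V has_real_derivative p t) (at t) \<and>
     (p has_real_derivative - c * p t - G R (V t)) (at t))"

definition osc_field :: "real \<Rightarrow> real \<times> real \<Rightarrow> real \<times> real" where
  "osc_field R z = (snd z, - c * snd z - G R (fst z))"

lemma osc_field_lipschitz:
  assumes "0 \<le> R"
  obtains L where "L-lipschitz_on UNIV (osc_field R)"
proof -
  obtain l where l: "0 \<le> l" "\<And>u v. \<bar>G R u - G R v\<bar> \<le> l * \<bar>u - v\<bar>"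
    using G_lipschitz[OF assms] by blast
  have "(1 + c + l)-lipschitz_on UNIV (osc_field R)"
  proof (rule lipschitz_onI)
    fix y z :: "real \<times> real"
    let ?d = "dist y z"
    have d: "\<bar>fst y - fst z\<bar> \<le> ?d" "\<bar>snd y - snd z\<bar> \<le> ?d"
      using dist_fst_le[of y z] dist_snd_le[of y z] by (simp_all add: dist_real_def)
    have "dist (osc_field R y) (osc_field R z)
        \<le> \<bar>snd y - snd z\<bar> + \<bar>(- c * snd y - G R (fst y)) - (- c * snd z - G R (fst z))\<bar>"
      using norm_Pair_le[of "snd y - snd z"
          "(- c * snd y - G R (fst y)) - (- c * snd z - G R (fst z))"]
      by (simp add: dist_norm osc_field_def)
    also have "\<dots> \<le> \<bar>snd y - snd z\<bar> + (\<bar>c * (snd y - snd z)\<bar> + \<bar>G R (fst y) - G R (fst z)\<bar>)"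
      by (simp add: right_diff_distrib)
    also have "\<dots> \<le> \<bar>snd y - snd z\<bar> + (c * \<bar>snd y - snd z\<bar> + l * \<bar>fst y - fst z\<bar>)"
      using l(2)[of "fst y" "fst z"] c by (simp add: abs_mult)
    also have "\<dots> \<le> ?d + (c * ?d + l * ?d)"
      using d l(1) c by (intro add_mono mult_left_mono) auto
    finally show "dist (osc_field R y) (osc_field R z) \<le> (1 + c + l) * ?d"
      by (simp add: algebra_simps)
  qed (use l c in auto)
  then show thesis by (rule that)
qed

lemma osc_iff_osc_field:
  "osc R V p \<longleftrightarrow>
     (\<forall>t. ((\<lambda>t. (V t, p t)) has_vector_derivative osc_field R (V t, p t)) (at t))"
proof -
  have "((\<lambda>t. (V t, p t)) has_vector_derivative (a, b)) (at t) \<longleftrightarrow>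
      (V has_real_derivative a) (at t) \<and> (p has_real_derivative b) (at t)" for a b t
  proof
    assume *: "((\<lambda>t. (V t, p t)) has_vector_derivative (a, b)) (at t)"
    from has_derivative_fst[OF this[unfolded has_vector_derivative_def]]
      has_derivative_snd[OF this[unfolded has_vector_derivative_def]]
    show "(V has_real_derivative a) (at t) \<and> (p has_real_derivative b) (at t)"
      by (simp add: has_real_derivative_iff_has_vector_derivative has_vector_derivative_def)
  qed (auto simp: has_real_derivative_iff_has_vector_derivative
      intro!: has_vector_derivative_Pair)
  then show ?thesis by (simp add: osc_def osc_field_def)
qed

lemma osc_exists:
  assumes "0 \<le> R"
  obtains V p where "osc R V p" "V 0 = v0" "p 0 = p0"
proof -
  obtain L where "L-lipschitz_on UNIV (osc_field R)"
    using osc_field_lipschitz[OF assms] .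
  then obtain x where x: "x 0 = (v0, p0)" "\<And>t. (x has_vector_derivative osc_field R (x t)) (at t)"
    using lipschitz_ode_exists by blast
  show thesis
    by (rule that[of "\<lambda>t. fst (x t)" "\<lambda>t. snd (x t)"]) (use x in \<open>auto simp: osc_iff_osc_field\<close>)
qed

text \<open>One \<open>C\<close> serves all pairs of orbits, so the state at a fixed time is a
  Lipschitz function of the peak height.\<close>

lemma osc_dependence:
  assumes "0 \<le> R" "0 \<le> t"
  obtains C where "\<And>V p W q. osc R V p \<Longrightarrow> osc R W q \<Longrightarrow>
    dist (V t, p t) (W t, q t) \<le> C * dist (V 0, p 0) (W 0, q 0)"
proof -
  obtain L where "L-lipschitz_on UNIV (osc_field R)"
    using osc_field_lipschitz[OF assms(1)] .
  note lipschitz_ode_dependence[OF this _ _ assms(2)]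
  from this[of "\<lambda>t. (V t, p t)" "\<lambda>t. (W t, q t)" for V p W q] show thesis
    by (intro that) (auto simp: osc_iff_osc_field)
qed

end

section \<open>Orbits released at rest from a peak\<close>

locale orbit = wave_params +
  fixes R M :: real and V p :: "real \<Rightarrow> real"
  assumes osc: "osc R V p" and V0: "V 0 = M" and p0: "p 0 = 0"
    and M: "0 < M" "M \<le> R"
begin

lemma R: "0 < R" using M by simp

lemma dV: "(V has_real_derivative p t) (at t)"
  and dp: "(p has_real_derivative - c * p t - G R (V t)) (at t)"
  using osc by (auto simp: osc_def)

lemma contV: "continuous_on S V"
  using dV by (blast intro: continuous_at_imp_continuous_on DERIV_isCont)

text \<open>The integrating factor removes the damping and leaves \<open>- G\<close>, which is never
  positive. Hence a negative velocity stays negative forwards, and a positive one stays positive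
  backwards.\<close>

lemma p_exp_mono: "s \<le> t \<Longrightarrow> p t * exp (c * t) \<le> p s * exp (c * s)"
proof (rule DERIV_nonpos_imp_nonincreasing[of s t "\<lambda>t. p t * exp (c * t)"])
  fix x
  have "((\<lambda>t. p t * exp (c * t)) has_real_derivative - G R (V x) * exp (c * x)) (at x)"
    by (auto intro!: derivative_eq_intros dp simp: algebra_simps)
  then show "\<exists>l. ((\<lambda>t. p t * exp (c * t)) has_real_derivative l) (at x) \<and> l \<le> 0"
    using G_nonneg by (intro exI conjI) (auto simp: mult_le_0_iff)
qed

text \<open>At time 0 the velocity vanishes with derivative \<open>- G R M < 0\<close>, which fixes
  its sign on both sides nearby; \<open>p_exp_mono\<close> carries the sign to all times.\<close>

lemma p_neg: "0 < t \<Longrightarrow> p t < 0" and p_pos: "t < 0 \<Longrightarrow> 0 < p t"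
proof -
  have d: "(p has_real_derivative - G R M) (at 0)" and "- G R M < 0"
    using dp[of 0] G_pos[OF R M(1)] by (auto simp: p0 V0)
  then obtain d1 d2 where d1: "d1 > 0" "\<And>h. 0 < h \<Longrightarrow> h < d1 \<Longrightarrow> p h < 0"
    and d2: "d2 > 0" "\<And>h. 0 < h \<Longrightarrow> h < d2 \<Longrightarrow> 0 < p (- h)"
    using DERIV_neg_dec_right[of p "- G R M" 0] DERIV_neg_dec_left[of p "- G R M" 0]
    by (auto simp: p0)
  show "p t < 0" if "0 < t"
  proof -
    have "p t * exp (c * t) \<le> p (min (d1 / 2) t) * exp (c * min (d1 / 2) t)"
      by (rule p_exp_mono) simp
    also have "\<dots> < 0"
      using d1(2)[of "min (d1 / 2) t"] d1(1) that by (simp add: mult_less_0_iff)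
    finally show ?thesis by (simp add: mult_less_0_iff)
  qed
  show "0 < p t" if "t < 0"
  proof -
    have "0 < p (- min (d2 / 2) (- t)) * exp (c * (- min (d2 / 2) (- t)))"
      using d2(2)[of "min (d2 / 2) (- t)"] d2(1) that by simp
    also have "\<dots> \<le> p t * exp (c * t)"
      by (rule p_exp_mono) simp
    finally show ?thesis by (simp add: zero_less_mult_iff)
  qed
qed

lemma V_decreasing: "0 \<le> s \<Longrightarrow> s < t \<Longrightarrow> V t < V s"
  using DERIV_neg_imp_decreasing_open[of s t V] dV p_neg contV by (meson le_less_trans)

lemma V_increasing: "t \<le> 0 \<Longrightarrow> s < t \<Longrightarrow> V s < V t"
  using DERIV_pos_imp_increasing_open[of s t V] dV p_pos contV by (meson less_le_trans)

lemma V_le_M: "V t \<le> M"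
  using V_decreasing[of 0 t] V_increasing[of 0 t] V0 by (cases t "0::real" rule: linorder_cases) auto

text \<open>Heights never exceed \<open>M \<le> R\<close>, so the upper truncation is never active
  along the orbit.\<close>

lemma G_V: "0 \<le> V t \<Longrightarrow> G R (V t) = m * \<mu> * V t powr (2 * m - 1)"
  using V_le_M[of t] M by (intro G_eq) auto

text \<open>Before the peak, damping and force both lower the velocity, so backwards in time it only
  grows. It thus stays above \<open>p (- 1) > 0\<close>, and \<open>V\<close> drops at least
  linearly in backward time.\<close>

lemma left_zero:
  obtains a where "a < 0" "V a = 0" "0 < p a" "\<And>t. a < t \<Longrightarrow> t \<le> 0 \<Longrightarrow> 0 < V t"
proof -
  have pmono: "p (- 1) \<le> p t" if "t \<le> - 1" for t
  proof (rule DERIV_nonpos_imp_nonincreasing[OF that])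
    fix x :: real assume "x \<le> - 1"
    then show "\<exists>l. (p has_real_derivative l) (at x) \<and> l \<le> 0"
      using dp[of x] mult_pos_pos[OF c p_pos[of x]] G_nonneg[of R "V x"]
      by (intro exI[of _ "- c * p x - G R (V x)"] conjI) auto
  qed
  have p1: "p (- 1) > 0" by (rule p_pos) simp
  \<comment> \<open>By this time a line of slope \<open>p (- 1)\<close> that has height
    \<open>M\<close> at time -1 has come down to zero.\<close>
  define T where "T = - 1 - M / p (- 1)"
  have T: "T \<le> - 1" using p1 M by (simp add: T_def)
  have "V T - p (- 1) * T \<le> V (- 1) - p (- 1) * (- 1)"
  proof (rule DERIV_nonneg_imp_nondecreasing[OF T])
    fix x :: real assume "x \<le> - 1"
    then show "\<exists>l. ((\<lambda>t. V t - p (- 1) * t) has_real_derivative l) (at x) \<and> 0 \<le> l"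
      using pmono by (intro exI[of _ "p x - p (- 1)"]) (auto intro!: derivative_eq_intros dV)
  qed
  moreover have "p (- 1) * T = - p (- 1) - M"
    using p1 by (simp add: T_def field_simps)
  ultimately have VT: "V T \<le> 0"
    using V_le_M[of "- 1"] by simp
  obtain a where a: "T \<le> a" "a \<le> 0" "V a = 0"
    using IVT'[of V T 0 0] VT V0 M T contV by auto
  have "a \<noteq> 0" using a V0 M by auto
  show thesis
  proof (rule that[of a])
    show "0 < V t" if "a < t" "t \<le> 0" for t
      using V_increasing[of t a] that a by auto
  qed (use a \<open>a \<noteq> 0\<close> p_pos[of a] in auto)
qed

text \<open>The force-free equation conserves \<open>p + c * V\<close>, so only the force changes
  it, and only downwards.\<close>

lemma w_mono: "s \<le> t \<Longrightarrow> p t + c * V t \<le> p s + c * V s"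
proof (rule DERIV_nonpos_imp_nonincreasing[of s t "\<lambda>t. p t + c * V t"])
  fix x
  have "((\<lambda>t. p t + c * V t) has_real_derivative - G R (V x)) (at x)"
    by (auto intro!: derivative_eq_intros dp dV)
  then show "\<exists>l. ((\<lambda>t. p t + c * V t) has_real_derivative l) (at x) \<and> l \<le> 0"
    using G_nonneg by (intro exI conjI) auto
qed

text \<open>By \<open>w_mono\<close> the sum \<open>p + c * V\<close> stays at or below its negative
  value \<open>- d\<close>. While \<open>V\<close> is positive this forces
  \<open>p \<le> - d\<close>, so \<open>V\<close> falls at rate at least \<open>d\<close> and is
  used up after time \<open>V s / d\<close>.\<close>

lemma hits_zero:
  assumes "0 \<le> s" "p s + c * V s < 0"
  obtains b where "0 < b" "V b = 0"
proof (cases "V s \<le> 0")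
  case True
  then obtain b where b: "0 \<le> b" "V b = 0"
    using IVT2'[of V s 0 0] V0 M contV assms by auto
  then show thesis using that[of b] V0 M by (cases "b = 0") auto
next
  case False
  define d where "d = - (p s + c * V s)"
  have d: "d > 0" using assms by (simp add: d_def)
  define T where "T = s + V s / d"
  have T: "s \<le> T" using d False by (simp add: T_def)
  have "\<exists>t\<ge>s. V t \<le> 0"
  proof (rule ccontr)
    assume "\<not> (\<exists>t\<ge>s. V t \<le> 0)"
    then have pos: "V t > 0" if "t \<ge> s" for t using that by force
    have "V T + d * T \<le> V s + d * s"
    proof (rule DERIV_nonpos_imp_nonincreasing[OF T])
      fix x assume x: "s \<le> x"
      have "0 < c * V x" using pos[OF x] c by simp
      then have "p x + d \<le> 0"
        using w_mono[OF x] by (simp add: d_def)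
      then show "\<exists>l. ((\<lambda>t. V t + d * t) has_real_derivative l) (at x) \<and> l \<le> 0"
        by (intro exI[of _ "p x + d"]) (auto intro!: derivative_eq_intros dV)
    qed
    moreover have "d * T = d * s + V s" using d by (simp add: T_def field_simps)
    ultimately have "V T \<le> 0" by linarith
    then show False using pos[OF T] by simp
  qed
  then obtain t where "t \<ge> s" "V t \<le> 0" by blast
  then obtain b where "0 \<le> b" "V b = 0"
    using IVT2'[of V t 0 0] V0 M contV assms by auto
  then show thesis using that[of b] V0 M by (cases "b = 0") auto
qed

text \<open>On the line \<open>p = - \<theta> * V\<close> the derivative of \<open>\<theta> * V + p\<close> equals
  \<open>(\<theta> * (c - \<theta>) - m * \<mu> * V powr (2 * m - 2)) * V\<close>, so orbits can only enter the sector
  above this line.\<close>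

lemma trap:
  assumes \<theta>: "0 < \<theta>" "\<theta> < c" and s: "0 \<le> s" "0 < V s" "0 \<le> \<theta> * V s + p s"
    and small: "m * \<mu> * V s powr (2 * m - 2) \<le> \<theta> * (c - \<theta>)" and t: "s \<le> t"
  shows "0 < V t" "0 \<le> \<theta> * V t + p t"
proof -
  have sector: "0 \<le> \<theta> * V t + p t" if t: "s \<le> t" and pos: "\<And>x. s \<le> x \<Longrightarrow> x < t \<Longrightarrow> 0 < V x" for t
  proof (cases "s = t")
    case False
    \<comment> \<open>The derivative of \<open>\<theta> * V + p\<close> is \<open>- (c - \<theta>) *
      (\<theta> * V + p) + \<theta> * (c - \<theta>) * V - G R V\<close>; the exponential absorbs
      the first term, and smallness of \<open>V\<close> makes the rest nonnegative.\<close>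
    define F where "F x = (\<theta> * V x + p x) * exp ((c - \<theta>) * x)" for x
    have F': "(F has_real_derivative
        (\<theta> * (c - \<theta>) * V x - G R (V x)) * exp ((c - \<theta>) * x)) (at x)" for x
      unfolding F_def by (auto intro!: derivative_eq_intros dV dp simp: algebra_simps)
    have "F s \<le> F t"
    proof (rule DERIV_nonneg_imp_increasing_open[of s t F])
      show "s \<le> t" by (rule t)
      show "continuous_on {s..t} F"
        using F' by (blast intro: continuous_at_imp_continuous_on DERIV_isCont)
      fix x assume x: "s < x" "x < t"
      have Vx: "0 < V x" "V x \<le> V s" using pos[of x] V_decreasing[of s x] x s by auto
      have "G R (V x) = (m * \<mu> * V x powr (2 * m - 2)) * V x"
        using G_V[of x] Vx powr_mult_base[of "V x" "2 * m - 2"] by (simp add: mult_ac)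
      also have "\<dots> \<le> \<theta> * (c - \<theta>) * V x"
      proof (rule mult_right_mono)
        have "m * \<mu> * V x powr (2 * m - 2) \<le> m * \<mu> * V s powr (2 * m - 2)"
          using Vx m \<mu> by (intro mult_left_mono powr_mono2) auto
        then show "m * \<mu> * V x powr (2 * m - 2) \<le> \<theta> * (c - \<theta>)" using small by linarith
      qed (use Vx in auto)
      finally show "\<exists>l. (F has_real_derivative l) (at x) \<and> 0 \<le> l"
        using F'[of x] by (intro exI conjI) auto
    qed
    moreover have "0 \<le> F s" using s by (simp add: F_def)
    ultimately have "0 \<le> F t" by simp
    then show ?thesis by (simp add: F_def zero_le_mult_iff)
  qed (use s in auto)
  have pos: "0 < V t" if st: "s \<le> t" for t
  proof (rule ccontr)
    assume "\<not> 0 < V t"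
    then obtain b where b: "s \<le> b" "b \<le> t" "V b = 0"
      using IVT2'[of V t 0 s] st s contV by auto
    have below: "0 < V x" if "s \<le> x" "x < b" for x
      using V_decreasing[of x b] that b s by auto
    \<comment> \<open>Inside the sector \<open>V' \<ge> - \<theta> * V\<close>, so \<open>V\<close>
      decays at most exponentially and cannot vanish at \<open>b\<close>.\<close>
    have "V s * exp (\<theta> * s) \<le> V b * exp (\<theta> * b)"
    proof (rule DERIV_nonneg_imp_nondecreasing[OF b(1)])
      fix x assume x: "s \<le> x" "x \<le> b"
      have "0 \<le> \<theta> * V x + p x" by (rule sector) (use x below in auto)
      moreover have "((\<lambda>t. V t * exp (\<theta> * t)) has_real_derivative
          (\<theta> * V x + p x) * exp (\<theta> * x)) (at x)"
        by (auto intro!: derivative_eq_intros dV simp: algebra_simps)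
      ultimately show "\<exists>l. ((\<lambda>t. V t * exp (\<theta> * t)) has_real_derivative l) (at x) \<and> 0 \<le> l"
        by (intro exI[of _ "(\<theta> * V x + p x) * exp (\<theta> * x)"] conjI) auto
    qed
    then show False using b s by (simp add: mult_le_0_iff)
  qed
  show "0 < V t" using pos t .
  show "0 \<le> \<theta> * V t + p t" using sector[OF t] pos by auto
qed

end

section \<open>Forward orbits near the origin: slow and fast direction\<close>

context orbit begin

lemma p_nonpos: "0 \<le> t \<Longrightarrow> p t \<le> 0"
  using p_neg[of t] p0 by (cases "t = 0") auto

lemma slope_bound:
  assumes pos: "\<And>t. 0 \<le> t \<Longrightarrow> 0 < V t" and t: "0 \<le> t"
  shows "0 \<le> p t + c * V t"
  using hits_zero[OF t] pos by (metis less_eq_real_def less_irrefl not_less)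

text \<open>If \<open>V\<close> stayed above some \<open>e\<close>, the force would stay above
  \<open>G R e\<close> and push \<open>p + c * V\<close> below zero, against
  \<open>slope_bound\<close>.\<close>

lemma V_tendsto_0:
  assumes pos: "\<And>t. 0 \<le> t \<Longrightarrow> 0 < V t"
  shows "(V \<longlongrightarrow> 0) at_top"
proof (rule order_tendstoI)
  show "\<forall>\<^sub>F t in at_top. l < V t" if "l < 0" for l
    using eventually_ge_at_top[of 0]
  proof eventually_elim
    case (elim t)
    then show ?case using pos[of t] that by linarith
  qed
  fix e :: real assume e: "0 < e"
  have "\<exists>T\<ge>0. V T < e"
  proof (rule ccontr)
    assume "\<not> (\<exists>T\<ge>0. V T < e)"
    then have ge: "e \<le> V t" if "0 \<le> t" for t using that by force
    define g where "g = G R e"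
    have g: "0 < g" using G_pos[OF R e] by (simp add: g_def)
    \<comment> \<open>The sum \<open>p + c * V\<close> starts at \<open>c * M\<close> and loses at
      least \<open>g\<close> per unit time, so at \<open>T\<close> it is at most
      \<open>- g\<close>.\<close>
    define T where "T = c * M / g + 1"
    have T: "0 \<le> T" using c M g by (simp add: T_def)
    have "p T + c * V T + g * T \<le> p 0 + c * V 0 + g * 0"
    proof (rule DERIV_nonpos_imp_nonincreasing[OF T])
      fix x :: real assume "0 \<le> x"
      then have "g \<le> G R (V x)" unfolding g_def using ge R by (intro G_mono) auto
      moreover have "((\<lambda>t. p t + c * V t + g * t) has_real_derivative g - G R (V x)) (at x)"
        by (auto intro!: derivative_eq_intros dp dV)
      ultimately show "\<exists>l. ((\<lambda>t. p t + c * V t + g * t) has_real_derivative l) (at x) \<and> l \<le> 0"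
        by (intro exI conjI) auto
    qed
    moreover have "g * T = c * M + g" using g by (simp add: T_def field_simps)
    ultimately show False using slope_bound[OF pos T] g by (simp add: p0 V0)
  qed
  then obtain T where "T \<ge> 0" "V T < e" by blast
  then show "\<forall>\<^sub>F t in at_top. V t < e"
    using V_decreasing[of T] unfolding eventually_at_top_linorder
    by (intro exI[of _ T]) (metis less_eq_real_def less_trans)
qed

lemma V_powr_tendsto_0:
  assumes "\<And>t. 0 \<le> t \<Longrightarrow> 0 < V t" "0 < a"
  shows "((\<lambda>t. V t powr a) \<longlongrightarrow> 0) at_top"
proof (rule tendsto_zero_powrI[OF V_tendsto_0 tendsto_const])
  show "\<forall>\<^sub>F t in at_top. 0 \<le> V t"
    using eventually_ge_at_top[of 0] by eventually_elim (use assms in \<open>auto intro: less_imp_le\<close>)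
qed (use assms in auto)

text \<open>The ratio \<open>r = - p / V\<close> obeys the Riccati equation
  \<open>r' = - c * r + r\<^sup>2 + m * \<mu> * V powr (2 * m - 2)\<close>. In the sector
  \<open>r \<le> \<theta>\<close>, so the quadratic term costs at most \<theta> of the decay rate
  \<open>c\<close>, and the inhomogeneity vanishes in the limit.\<close>

lemma ratio_tendsto_0:
  assumes pos: "\<And>t. 0 \<le> t \<Longrightarrow> 0 < V t" and \<theta>: "\<theta> < c"
    and sector: "\<And>t. s \<le> t \<Longrightarrow> 0 \<le> \<theta> * V t + p t"
  shows "((\<lambda>t. - p t / V t) \<longlongrightarrow> 0) at_top"
proof (rule linear_decay[where \<kappa> = "c - \<theta>" and h = "\<lambda>t. m * \<mu> * V t powr (2 * m - 2)"
      and y' = "\<lambda>t. - c * (- p t / V t) + (- p t / V t)\<^sup>2 + m * \<mu> * V t powr (2 * m - 2)"])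
  show "\<forall>\<^sub>F t in at_top. ((\<lambda>t. - p t / V t) has_real_derivative
      - c * (- p t / V t) + (- p t / V t)\<^sup>2 + m * \<mu> * V t powr (2 * m - 2)) (at t) \<and>
      - c * (- p t / V t) + (- p t / V t)\<^sup>2 + m * \<mu> * V t powr (2 * m - 2)
        \<le> - (c - \<theta>) * (- p t / V t) + m * \<mu> * V t powr (2 * m - 2)"
    using eventually_ge_at_top[of "max 0 s"]
  proof eventually_elim
    case (elim t)
    then have t: "0 < V t" "p t \<le> 0" "0 \<le> \<theta> * V t + p t"
      using pos p_nonpos sector by auto
    have GV: "G R (V t) = V t * (m * \<mu> * V t powr (2 * m - 2))"
      using G_V[of t] t powr_mult_base[of "V t" "2 * m - 2"] by (simp add: mult_ac)
    have "((\<lambda>t. - p t / V t) has_real_derivative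
        (- (- c * p t - G R (V t)) * V t - - p t * p t) / (V t * V t)) (at t)"
      by (rule DERIV_divide DERIV_minus dV dp)+ (use t in auto)
    also have "(- (- c * p t - G R (V t)) * V t - - p t * p t) / (V t * V t)
        = - c * (- p t / V t) + (- p t / V t)\<^sup>2 + m * \<mu> * V t powr (2 * m - 2)"
      unfolding GV using t by (simp add: power2_eq_square field_simps)
    finally have 1: "((\<lambda>t. - p t / V t) has_real_derivative \<dots>) (at t)" .
    have "0 \<le> - p t / V t" "- p t / V t \<le> \<theta>" using t by (auto simp: field_simps)
    then have "(- p t / V t)\<^sup>2 \<le> \<theta> * (- p t / V t)"
      unfolding power2_eq_square by (intro mult_right_mono)
    moreover have "- (c - \<theta>) * (- p t / V t) = - c * (- p t / V t) + \<theta> * (- p t / V t)"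
      by (simp only: left_diff_distrib minus_diff_eq)
    ultimately show ?case using 1 by linarith
  qed
  show "\<forall>\<^sub>F t in at_top. 0 \<le> - p t / V t"
    using eventually_ge_at_top[of 0]
    by eventually_elim (use pos p_nonpos in \<open>auto intro!: divide_nonpos_pos\<close>)
  show "((\<lambda>t. m * \<mu> * V t powr (2 * m - 2)) \<longlongrightarrow> 0) at_top"
    using tendsto_mult_left[OF V_powr_tendsto_0[OF pos], of "2 * m - 2" "m * \<mu>"] m by simp
qed (use \<theta> in auto)

text \<open>The quotient \<open>\<rho> = - p / V powr (2 * m - 1)\<close> obeys
  \<open>\<rho>' = m * \<mu> - \<rho> * (c - (2 * m - 1) * r)\<close> with \<open>r\<close> tending
  to 0, so it is attracted by \<open>m * \<mu> / c\<close>. The squared deviation is used because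
  \<open>linear_decay\<close> asks for a nonnegative quantity.\<close>

lemma slow_ratio:
  assumes pos: "\<And>t. 0 \<le> t \<Longrightarrow> 0 < V t" and r0: "((\<lambda>t. - p t / V t) \<longlongrightarrow> 0) at_top"
  shows "((\<lambda>t. p t / V t powr (2 * m - 1)) \<longlongrightarrow> - (m * \<mu> / c)) at_top"
proof -
  define \<rho>0 where "\<rho>0 = m * \<mu> / c"
  define r where "r t = - p t / V t" for t
  define \<rho> where "\<rho> t = - p t / V t powr (2 * m - 1)" for t
  have \<rho>0: "0 \<le> \<rho>0" "c * \<rho>0 = m * \<mu>" using m \<mu> c by (auto simp: \<rho>0_def)
  have r: "(r \<longlongrightarrow> 0) at_top" using r0 by (simp add: r_def[abs_def])
  have d\<rho>: "(\<rho> has_real_derivative m * \<mu> - \<rho> t * (c - (2 * m - 1) * r t)) (at t)"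
    if t: "0 \<le> t" for t
  proof -
    have Vt: "0 < V t" using pos t by simp
    let ?P = "V t powr (2 * m - 1)"
    have P: "0 < ?P" using Vt by simp
    have P2: "V t powr (2 * m - 1 - 1) = ?P / V t"
      using Vt by (simp add: powr_diff power2_eq_square)
    have alg: "(- (- c * q - g * P) * P - - q * (n * (P / v) * q)) / (P * P)
        = g - (- q / P) * (c - n * (- q / v))" if "0 < v" "0 < P" for v P q g n :: real
      using that by (simp add: field_simps)
    have "(\<rho> has_real_derivative
        (- (- c * p t - G R (V t)) * ?P - - p t * ((2 * m - 1) * V t powr (2 * m - 1 - of_nat 1) * p t))
          / (?P * ?P)) (at t)"
      unfolding \<rho>_def
      by (rule DERIV_divide DERIV_minus dp DERIV_fun_powr dV Vt)+ (use P in auto)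
    then show ?thesis
      unfolding \<rho>_def r_def using alg[OF Vt P] G_V[of t] Vt P2 by simp
  qed
  have "((\<lambda>t. (\<rho> t - \<rho>0)\<^sup>2) \<longlongrightarrow> 0) at_top"
  proof (rule linear_decay[OF c, where h = "\<lambda>t. (2 * m - 1) * r t * \<rho>0"
        and y' = "\<lambda>t. 2 * (\<rho> t - \<rho>0) * (m * \<mu> - \<rho> t * (c - (2 * m - 1) * r t))"])
    \<comment> \<open>The squared deviation decays at rate \<open>2 * c\<close> up to terms carrying
      \<open>r\<close>. After \<open>2 * d \<le> 1 + d\<^sup>2\<close> these are
      \<open>(2 * m - 1) * r * (2 + \<rho>0) * d\<^sup>2\<close>, which consumes at most half of
      that rate, and a remainder that tends to 0.\<close>
    have "((\<lambda>t. (2 * m - 1) * r t * (2 + \<rho>0)) \<longlongrightarrow> (2 * m - 1) * 0 * (2 + \<rho>0)) at_top"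
      by (intro tendsto_intros r)
    then have "\<forall>\<^sub>F t in at_top. (2 * m - 1) * r t * (2 + \<rho>0) < c"
      using c by (intro order_tendstoD(2)) auto
    then show "\<forall>\<^sub>F t in at_top. ((\<lambda>t. (\<rho> t - \<rho>0)\<^sup>2) has_real_derivative
          2 * (\<rho> t - \<rho>0) * (m * \<mu> - \<rho> t * (c - (2 * m - 1) * r t))) (at t) \<and>
        2 * (\<rho> t - \<rho>0) * (m * \<mu> - \<rho> t * (c - (2 * m - 1) * r t))
          \<le> - c * (\<rho> t - \<rho>0)\<^sup>2 + (2 * m - 1) * r t * \<rho>0"
      using eventually_ge_at_top[of 0]
    proof eventually_elim
      case (elim t)
      let ?d = "\<rho> t - \<rho>0" and ?k = "(2 * m - 1) * r t"
      have "0 \<le> r t" using pos[of t] p_nonpos[of t] elim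
        by (auto simp: r_def intro!: divide_nonpos_pos)
      then have k: "0 \<le> ?k" using m by simp
      have "2 * ?d \<le> 1 + ?d\<^sup>2"
        using zero_le_power2[of "1 - ?d"] by (simp add: power2_eq_square algebra_simps)
      then have 1: "?k * \<rho>0 * (2 * ?d) \<le> ?k * \<rho>0 * (1 + ?d\<^sup>2)"
        using k \<rho>0 by (intro mult_left_mono) auto
      have 2: "(?k * (2 + \<rho>0)) * ?d\<^sup>2 \<le> c * ?d\<^sup>2"
        using elim by (intro mult_right_mono) auto
      have "2 * ?d * (m * \<mu> - \<rho> t * (c - ?k)) = - 2 * c * ?d\<^sup>2 + 2 * ?k * ?d\<^sup>2 + ?k * \<rho>0 * (2 * ?d)"
        unfolding \<rho>0(2)[symmetric] by (simp add: power2_eq_square algebra_simps)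
      also have "\<dots> \<le> - 2 * c * ?d\<^sup>2 + (?k * (2 + \<rho>0)) * ?d\<^sup>2 + ?k * \<rho>0"
        using 1 by (simp add: algebra_simps)
      also have "\<dots> \<le> - c * ?d\<^sup>2 + ?k * \<rho>0"
        using 2 by (simp add: algebra_simps)
      finally show ?case
        using d\<rho>[of t] elim by (auto intro!: derivative_eq_intros)
    qed
    have "((\<lambda>t. (2 * m - 1) * r t * \<rho>0) \<longlongrightarrow> (2 * m - 1) * 0 * \<rho>0) at_top"
      by (intro tendsto_intros r)
    then show "((\<lambda>t. (2 * m - 1) * r t * \<rho>0) \<longlongrightarrow> 0) at_top" by simp
  qed auto
  then have "((\<lambda>t. \<rho> t - \<rho>0) \<longlongrightarrow> 0) at_top"
    using tendsto_real_sqrt[of "\<lambda>t. (\<rho> t - \<rho>0)\<^sup>2" 0] by (simp add: tendsto_rabs_zero_iff)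
  then have "((\<lambda>t. - ((\<rho> t - \<rho>0) + \<rho>0)) \<longlongrightarrow> - (0 + \<rho>0)) at_top"
    by (intro tendsto_intros)
  then show ?thesis by (simp add: \<rho>_def \<rho>0_def)
qed

text \<open>The upper bound \<open>c\<close> on the ratio is \<open>slope_bound\<close>. If the
  ratio were at most some \<open>\<theta> < c\<close> at a late time, \<open>trap\<close> would hold
  the orbit in that sector and \<open>ratio_tendsto_0\<close> would send the ratio to 0, although it
  is eventually at least \<open>c / 2\<close>.\<close>

lemma fast_ratio:
  assumes pos: "\<And>t. 0 \<le> t \<Longrightarrow> 0 < V t"
    and steep: "\<forall>\<^sub>F t in at_top. p t \<le> - (c / 2) * V t"
  shows "((\<lambda>t. - p t / V t) \<longlongrightarrow> c) at_top"
proof (rule order_tendstoI)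
  show "\<forall>\<^sub>F t in at_top. - p t / V t < l" if "c < l" for l
    using eventually_ge_at_top[of 0]
  proof eventually_elim
    case (elim t)
    have "- p t / V t \<le> c"
      using slope_bound[OF pos elim] pos[OF elim] by (simp add: field_simps)
    then show ?case using that by linarith
  qed
  fix l assume l: "l < c"
  \<comment> \<open>Raising \<open>l\<close> to at least \<open>c / 2\<close> provides the positive
    slope that \<open>trap\<close> needs.\<close>
  define \<theta> where "\<theta> = max l (c / 2)"
  have \<theta>: "0 < \<theta>" "\<theta> < c" "l \<le> \<theta>" using l c by (auto simp: \<theta>_def)
  have "((\<lambda>t. m * \<mu> * V t powr (2 * m - 2)) \<longlongrightarrow> m * \<mu> * 0) at_top"
    using m by (intro tendsto_intros V_powr_tendsto_0 pos) auto
  then have "\<forall>\<^sub>F t in at_top. m * \<mu> * V t powr (2 * m - 2) < \<theta> * (c - \<theta>)"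
    using \<theta> by (intro order_tendstoD(2)) auto
  then show "\<forall>\<^sub>F t in at_top. l < - p t / V t"
    using eventually_ge_at_top[of 0]
  proof eventually_elim
    case (elim s)
    show ?case
    proof (rule ccontr)
      assume "\<not> l < - p s / V s"
      then have "- p s / V s \<le> \<theta>" using \<theta> by linarith
      then have "0 \<le> \<theta> * V s + p s" using pos[of s] elim by (simp add: field_simps)
      from trap(2)[OF \<theta>(1,2) _ _ this] elim pos[of s]
      have "0 \<le> \<theta> * V t + p t" if "s \<le> t" for t using that by auto
      from ratio_tendsto_0[OF pos \<theta>(2) this]
      have "\<forall>\<^sub>F t in at_top. - p t / V t < c / 2"
        using c by (intro order_tendstoD(2)) auto
      with steep eventually_ge_at_top[of "0::real"] have "\<forall>\<^sub>F t in at_top :: real filter. False"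
      proof eventually_elim
        case (elim t)
        then show ?case using pos[of t] by (simp add: field_simps)
      qed
      then show False by simp
    qed
  qed
qed

text \<open>Otherwise \<open>V' \<ge> - c * V\<close> keeps \<open>V\<close> above
  \<open>M * exp (- c * t)\<close>. The force then removes at least
  \<open>A / (n * c) * (1 - exp (- n * c))\<close> from \<open>p + c * V\<close> during the first
  unit of time, and the hypothesis says that this exceeds the initial value
  \<open>c * M\<close>.\<close>

lemma large_hits_zero:
  assumes large: "(2 * m - 1) * c\<^sup>2 < m * \<mu> * M powr (2 * m - 2) * (1 - exp (- ((2 * m - 1) * c)))"
  shows "\<exists>b>0. V b = 0"
proof (rule ccontr)
  assume no: "\<not> (\<exists>b>0. V b = 0)"
  have pos: "0 < V t" if t0: "0 \<le> t" for t
  proof (rule ccontr)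
    assume "\<not> 0 < V t"
    then obtain b where b: "0 \<le> b" "V b = 0"
      using IVT2'[of V t 0 0] V0 M contV t0 by auto
    then have "b \<noteq> 0" using V0 M by auto
    then show False using b no by auto
  qed
  have Vlow: "M * exp (- (c * t)) \<le> V t" if "0 \<le> t" for t
  proof -
    have "V 0 * exp (c * 0) \<le> V t * exp (c * t)"
    proof (rule DERIV_nonneg_imp_nondecreasing[OF that])
      fix x :: real assume "0 \<le> x"
      then have "0 \<le> p x + c * V x" using slope_bound pos by simp
      moreover have "((\<lambda>t. V t * exp (c * t)) has_real_derivative (p x + c * V x) * exp (c * x)) (at x)"
        by (auto intro!: derivative_eq_intros dV simp: algebra_simps)
      ultimately show "\<exists>l. ((\<lambda>t. V t * exp (c * t)) has_real_derivative l) (at x) \<and> 0 \<le> l"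
        by (intro exI[of _ "(p x + c * V x) * exp (c * x)"] conjI) auto
    qed
    then show ?thesis by (simp add: V0 exp_minus field_simps)
  qed
  define n where "n = 2 * m - 1"
  define A where "A = m * \<mu> * M powr n"
  have n: "0 < n" "0 < n * c" using m c by (auto simp: n_def)
  \<comment> \<open>The last term is a primitive of the guaranteed force
    \<open>A * exp (- (n * c * t))\<close>, so \<open>k'\<close> is that lower bound minus the
    actual force.\<close>
  define k where "k t = p t + c * V t - A / (n * c) * exp (- (n * c * t))" for t
  have "k 1 \<le> k 0"
  proof (rule DERIV_nonpos_imp_nonincreasing[of 0 1 k])
    fix x :: real assume x: "0 \<le> x"
    have "A * exp (- (n * c * x)) = m * \<mu> * (M * exp (- (c * x))) powr n"
      using M by (simp add: A_def powr_mult exp_powr_real mult_ac)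
    also have "\<dots> \<le> m * \<mu> * V x powr n"
      using Vlow[OF x] m \<mu> M n by (intro mult_left_mono powr_mono2) auto
    also have "\<dots> = G R (V x)"
      using G_V[of x] pos[OF x] by (simp add: n_def)
    finally have "A * exp (- (n * c * x)) - G R (V x) \<le> 0" by simp
    moreover have "(k has_real_derivative A * exp (- (n * c * x)) - G R (V x)) (at x)"
      unfolding k_def using n by (auto intro!: derivative_eq_intros dp dV)
    ultimately show "\<exists>l. (k has_real_derivative l) (at x) \<and> l \<le> 0" by blast
  qed simp
  then have "A / (n * c) * (1 - exp (- (n * c))) \<le> c * M"
    using slope_bound[OF pos, of 1] by (simp add: k_def p0 V0 algebra_simps)
  then have "A * (1 - exp (- (n * c))) \<le> n * c\<^sup>2 * M"
    using n by (simp add: field_simps power2_eq_square)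
  moreover have "A = m * \<mu> * M powr (2 * m - 2) * M"
    using M powr_mult_base[of M "2 * m - 2"] by (simp add: A_def n_def mult_ac)
  ultimately have "(m * \<mu> * M powr (2 * m - 2) * (1 - exp (- (n * c)))) * M \<le> n * c\<^sup>2 * M"
    by (simp add: mult_ac)
  then have "m * \<mu> * M powr (2 * m - 2) * (1 - exp (- (n * c))) \<le> n * c\<^sup>2"
    using M by (simp add: mult_le_cancel_right)
  then show False using large by (simp add: n_def)
qed

end

section \<open>Thresholds for the peak height and the connectedness argument\<close>

context wave_params begin

text \<open>This is the smallness condition of \<open>trap\<close> at \<theta> =
  \<open>c / 2\<close>, the slope that maximises \<open>\<theta> * (c - \<theta>)\<close>.\<close>

lemma small_threshold:
  obtains v0 where "0 < v0"
    "\<And>v. 0 \<le> v \<Longrightarrow> v \<le> v0 \<Longrightarrow> m * \<mu> * v powr (2 * m - 2) \<le> c / 2 * (c - c / 2)"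
proof
  let ?e = "c / 2 * (c - c / 2) / (m * \<mu>)"
  let ?v0 = "?e powr (1 / (2 * m - 2))"
  have e: "0 < ?e" using c m \<mu> by (intro divide_pos_pos mult_pos_pos) auto
  then show "0 < ?v0" by (simp only: powr_gt_zero)
  fix v assume "0 \<le> v" "v \<le> ?v0"
  then have "v powr (2 * m - 2) \<le> ?v0 powr (2 * m - 2)"
    using m by (intro powr_mono2) auto
  also have "\<dots> = ?e" by (rule powr_inverse_powr) (use e m in auto)
  finally show "m * \<mu> * v powr (2 * m - 2) \<le> c / 2 * (c - c / 2)"
    using m \<mu> by (simp add: field_simps)
qed

lemma large_threshold:
  obtains M1 where "0 < M1"
    "\<And>M. M1 \<le> M \<Longrightarrow>
      (2 * m - 1) * c\<^sup>2 < m * \<mu> * M powr (2 * m - 2) * (1 - exp (- ((2 * m - 1) * c)))"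
proof
  let ?k = "m * \<mu> * (1 - exp (- ((2 * m - 1) * c)))"
  \<comment> \<open>The summand 1 makes the final inequality strict.\<close>
  let ?e = "((2 * m - 1) * c\<^sup>2 + 1) / ?k"
  let ?M1 = "?e powr (1 / (2 * m - 2))"
  have k: "0 < ?k" using m \<mu> c by simp
  have e: "0 < ?e" using k c m by (intro divide_pos_pos add_nonneg_pos) auto
  then show "0 < ?M1" by (simp only: powr_gt_zero)
  fix M assume "?M1 \<le> M"
  then have "?M1 powr (2 * m - 2) \<le> M powr (2 * m - 2)"
    using m by (intro powr_mono2) auto
  also have "?M1 powr (2 * m - 2) = ?e" by (rule powr_inverse_powr) (use e m in auto)
  finally have "(2 * m - 1) * c\<^sup>2 + 1 \<le> M powr (2 * m - 2) * ?k"
    using k by (simp only: pos_divide_le_eq)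
  then show "(2 * m - 1) * c\<^sup>2 < m * \<mu> * M powr (2 * m - 2) * (1 - exp (- ((2 * m - 1) * c)))"
    by (simp add: mult_ac)
qed

lemma orbit_exists:
  assumes "0 < M" "M \<le> R"
  obtains V p where "orbit m \<mu> c R M V p"
proof -
  obtain V p where "osc R V p" "V 0 = M" "p 0 = 0"
    using osc_exists[of R M 0] assms by auto
  then show thesis
    using assms by (intro that[of V p]) (unfold_locales, auto)
qed

text \<open>The peak heights whose orbits enter the trapping sector and those whose orbits reach
  zero with nonzero speed form disjoint nonempty open sets; connectedness yields a height
  in between, and its orbit approaches the origin along the fast direction.\<close>

lemma fast_orbit_exists:
  obtains R M V p where "orbit m \<mu> c R M V p" "\<And>t. 0 \<le> t \<Longrightarrow> 0 < V t"
    "((\<lambda>t. - p t / V t) \<longlongrightarrow> c) at_top"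
proof -
  obtain v0 where v0: "0 < v0"
    and small: "\<And>v. 0 \<le> v \<Longrightarrow> v \<le> v0 \<Longrightarrow> m * \<mu> * v powr (2 * m - 2) \<le> c / 2 * (c - c / 2)"
    using small_threshold by blast
  obtain M1 where M1: "0 < M1"
    and large: "\<And>M. M1 \<le> M \<Longrightarrow>
      (2 * m - 1) * c\<^sup>2 < m * \<mu> * M powr (2 * m - 2) * (1 - exp (- ((2 * m - 1) * c)))"
    using large_threshold by blast
  \<comment> \<open>A common truncation level puts all heights under the same vector field, so that
    their orbits can be compared.\<close>
  define R where "R = max v0 M1"
  have R: "0 \<le> R" using v0 by (simp add: R_def)
  \<comment> \<open>The lower end lies strictly below \<open>v0\<close>, so its orbit starts inside
    \<open>S1\<close>; the upper end is at least \<open>M1\<close>, so its orbit reaches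
    zero.\<close>
  define I where "I = {v0 / 2..R}"
  have I: "0 < M" "M \<le> R" if "M \<in> I" for M using that v0 by (auto simp: I_def)
  have "\<exists>V p. orbit m \<mu> c R M V p" if "M \<in> I" for M
    using orbit_exists[OF I[OF that]] by metis
  then obtain V p where orb: "\<And>M. M \<in> I \<Longrightarrow> orbit m \<mu> c R M (V M) (p M)"
    by metis
  have cont: "continuous_on I (\<lambda>M. (V M t, p M t))" if t: "0 \<le> t" for t
  proof -
    obtain C where C: "\<And>V p W q. osc R V p \<Longrightarrow> osc R W q \<Longrightarrow>
        dist (V t, p t) (W t, q t) \<le> C * dist (V 0, p 0) (W 0, q 0)"
      using osc_dependence[OF R t] by metis
    have "dist (V M t, p M t) (V N t, p N t) \<le> max C 0 * dist M N" if "M \<in> I" "N \<in> I" for M N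
    proof -
      interpret A: orbit m \<mu> c R M "V M" "p M" using orb that by simp
      interpret B: orbit m \<mu> c R N "V N" "p N" using orb that by simp
      have "dist (V M t, p M t) (V N t, p N t) \<le> C * dist M N"
        using C[OF A.osc B.osc] by (simp add: A.V0 A.p0 B.V0 B.p0 dist_prod_def)
      also have "\<dots> \<le> max C 0 * dist M N" by (intro mult_right_mono) auto
      finally show ?thesis .
    qed
    then have "(max C 0)-lipschitz_on I (\<lambda>M. (V M t, p M t))"
      by (intro lipschitz_onI) auto
    then show ?thesis by (rule lipschitz_on_continuous_on)
  qed
  \<comment> \<open>Heights whose orbit visits \<open>S\<close> at some time \<ge> 0. For open
    \<open>S\<close> this is a union of preimages under continuous maps, hence relatively open in
    \<open>I\<close>.\<close>
  define reach where "reach S = (\<Union>t\<in>{0..}. I \<inter> (\<lambda>M. (V M t, p M t)) -` S)" for S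
  have open_reach: "openin (top_of_set I) (reach S)" if "open S" for S
    unfolding reach_def using cont that
    by (intro openin_Union ballI) (auto intro!: continuous_openin_preimage_gen)
  \<comment> \<open>\<open>S1\<close> is the interior of the trapping sector below the threshold;
    \<open>S2\<close> is the condition of \<open>hits_zero\<close>. Strict inequalities keep both
    open.\<close>
  define S1 where "S1 = {z::real \<times> real. 0 < fst z} \<inter> {z. fst z < v0} \<inter> {z. - (c / 2) * fst z < snd z}"
  define S2 where "S2 = {z::real \<times> real. snd z + c * fst z < 0}"
  have S: "open S1" "open S2"
    unfolding S1_def S2_def by (auto intro!: open_Int open_Collect_less continuous_intros)
  have disj: "reach S1 \<inter> reach S2 = {}"
  proof safe
    fix M assume HM: "M \<in> reach S1" "M \<in> reach S2"
    then have MI: "M \<in> I" by (auto simp: reach_def)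
    interpret orbit m \<mu> c R M "V M" "p M" using orb MI .
    obtain s where s: "0 \<le> s" "0 < V M s" "V M s < v0" "- (c / 2) * V M s < p M s"
      using HM by (auto simp: reach_def S1_def)
    obtain u where "0 \<le> u" "p M u + c * V M u < 0"
      using HM by (auto simp: reach_def S2_def)
    then obtain b where b: "0 < b" "V M b = 0" using hits_zero by blast
    \<comment> \<open>A visit to \<open>S1\<close> up to time \<open>b\<close> would keep
      \<open>V\<close> positive at \<open>b\<close>; after \<open>b\<close>, \<open>V\<close> is
      negative, which \<open>S1\<close> excludes.\<close>
    show "M \<in> {}"
    proof (cases "s \<le> b")
      case True
      then show ?thesis
        using trap(1)[of "c / 2" s b] s c b small[of "V M s"] by auto
    next
      case False
      then show ?thesis using V_decreasing[of b s] b s by auto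
    qed
  qed
  have ne1: "reach S1 \<noteq> {}"
  proof -
    have MI: "v0 / 2 \<in> I" using v0 by (auto simp: I_def R_def)
    interpret orbit m \<mu> c R "v0 / 2" "V (v0 / 2)" "p (v0 / 2)" using orb MI .
    have "v0 / 2 \<in> reach S1"
      using MI v0 c by (auto simp: reach_def S1_def V0 p0 intro!: bexI[of _ 0])
    then show ?thesis by blast
  qed
  have ne2: "reach S2 \<noteq> {}"
  proof -
    have MI: "R \<in> I" using v0 by (auto simp: I_def R_def)
    interpret orbit m \<mu> c R R "V R" "p R" using orb MI .
    obtain b where b: "0 < b" "V R b = 0"
      using large_hits_zero large[of R] by (auto simp: R_def)
    then have "R \<in> reach S2"
      using MI p_neg[of b] by (auto simp: reach_def S2_def intro!: bexI[of _ b])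
    then show ?thesis by blast
  qed
  have "connected I" by (simp add: I_def)
  then have "\<not> I \<subseteq> reach S1 \<union> reach S2"
    using open_reach[OF S(1)] open_reach[OF S(2)] disj ne1 ne2
    unfolding connected_openin by blast
  then obtain M where HM: "M \<in> I" "M \<notin> reach S1" "M \<notin> reach S2" by blast
  interpret orbit m \<mu> c R M "V M" "p M" using orb HM(1) .
  have pos: "0 < V M t" if t0: "0 \<le> t" for t
  proof (rule ccontr)
    assume "\<not> 0 < V M t"
    then obtain b where b: "0 \<le> b" "V M b = 0"
      using IVT2'[of "V M" t 0 0] V0 I[OF HM(1)] contV t0 by auto
    then have "b \<noteq> 0" using V0 I[OF HM(1)] by auto
    then have "M \<in> reach S2"
      using b HM(1) p_neg[of b] by (auto simp: reach_def S2_def intro!: bexI[of _ b])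
    then show False using HM by simp
  qed
  \<comment> \<open>Once \<open>V\<close> is in the range (0, \<open>v0\<close>), avoiding
    \<open>S1\<close> can only mean that the slope condition fails, which is the steepness required
    by \<open>fast_ratio\<close>.\<close>
  have "\<forall>\<^sub>F t in at_top. V M t < v0"
    using V_tendsto_0[OF pos] v0 by (rule order_tendstoD(2))
  then have "\<forall>\<^sub>F t in at_top. p M t \<le> - (c / 2) * V M t"
    using eventually_ge_at_top[of 0]
  proof eventually_elim
    case (elim t)
    then show ?case using HM pos[of t] by (force simp: reach_def S1_def not_less)
  qed
  from that[OF orb[OF HM(1)] pos fast_ratio[OF pos this]] show thesis by blast
qed

end

section \<open>End behaviour from \<open>W' * W powr (a - 1) \<longlongrightarrow> K\<close>\<close>

lemma powr_ratio_tendsto: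
  fixes W y :: "'b \<Rightarrow> real"
  assumes "a \<noteq> 0" and pos: "\<forall>\<^sub>F \<xi> in F. 0 < W \<xi> \<and> 0 < y \<xi>"
    and lim: "((\<lambda>\<xi>. W \<xi> powr a / y \<xi>) \<longlongrightarrow> l) F" and l: "0 < l"
  shows "((\<lambda>\<xi>. W \<xi> powr b / (l powr (b / a) * y \<xi> powr (b / a))) \<longlongrightarrow> 1) F"
proof -
  have "((\<lambda>\<xi>. (W \<xi> powr a / y \<xi>) powr (b / a) / l powr (b / a))
      \<longlongrightarrow> l powr (b / a) / l powr (b / a)) F"
    by (intro tendsto_intros lim) (use l in auto)
  moreover have "\<forall>\<^sub>F \<xi> in F. (W \<xi> powr a / y \<xi>) powr (b / a) / l powr (b / a)
      = W \<xi> powr b / (l powr (b / a) * y \<xi> powr (b / a))"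
    using pos by eventually_elim (use assms(1) in \<open>simp add: powr_divide powr_powr mult_ac\<close>)
  ultimately have "((\<lambda>\<xi>. W \<xi> powr b / (l powr (b / a) * y \<xi> powr (b / a)))
      \<longlongrightarrow> l powr (b / a) / l powr (b / a)) F"
    by (rule Lim_transform_eventually)
  then show ?thesis using l by simp
qed

text \<open>Roots of \<open>W powr a \<sim> l * y\<close> give \<open>W\<close>, and
  \<open>D \<sim> K * W powr (1 - a)\<close> then gives the slope. The filter, the gauge
  \<open>y\<close> and the sign of \<open>a\<close> are left open to cover both finite ends and
  infinity.\<close>

lemma sim_abs_powr_profile:
  assumes "a \<noteq> 0" and pos: "\<forall>\<^sub>F \<xi> in F. 0 < W \<xi> \<and> 0 < y \<xi>"
    and lim: "((\<lambda>\<xi>. W \<xi> powr a / y \<xi>) \<longlongrightarrow> l) F" and l: "0 < l"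
    and D: "((\<lambda>\<xi>. D \<xi> * W \<xi> powr (a - 1)) \<longlongrightarrow> K) F" and K: "K \<noteq> 0"
  shows "sim_abs W (\<lambda>\<xi>. l powr (1 / a) * y \<xi> powr (1 / a)) F"
    and "sim_abs D (\<lambda>\<xi>. K * l powr ((1 - a) / a) * y \<xi> powr ((1 - a) / a)) F"
proof -
  note * = powr_ratio_tendsto[OF assms(1) pos lim l]
  have "\<forall>\<^sub>F \<xi> in F. W \<xi> powr 1 / (l powr (1 / a) * y \<xi> powr (1 / a))
      = W \<xi> / (l powr (1 / a) * y \<xi> powr (1 / a))"
    using pos by eventually_elim simp
  with *[of 1] have "((\<lambda>\<xi>. W \<xi> / (l powr (1 / a) * y \<xi> powr (1 / a))) \<longlongrightarrow> 1) F"
    by (rule Lim_transform_eventually)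
  from tendsto_rabs[OF this] show "sim_abs W (\<lambda>\<xi>. l powr (1 / a) * y \<xi> powr (1 / a)) F"
    by (simp add: sim_abs_def)
  have "((\<lambda>\<xi>. D \<xi> * W \<xi> powr (a - 1) / K *
      (W \<xi> powr (1 - a) / (l powr ((1 - a) / a) * y \<xi> powr ((1 - a) / a)))) \<longlongrightarrow> K / K * 1) F"
    by (intro tendsto_intros D *) (use K in auto)
  moreover have "\<forall>\<^sub>F \<xi> in F. D \<xi> * W \<xi> powr (a - 1) / K *
      (W \<xi> powr (1 - a) / (l powr ((1 - a) / a) * y \<xi> powr ((1 - a) / a)))
      = D \<xi> / (K * l powr ((1 - a) / a) * y \<xi> powr ((1 - a) / a))"
    using pos
  proof eventually_elim
    case (elim \<xi>)
    then have "W \<xi> powr (a - 1) * W \<xi> powr (1 - a) = 1" by (simp flip: powr_add)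
    then have "W \<xi> powr (1 - a) = inverse (W \<xi> powr (a - 1))" "W \<xi> powr (a - 1) \<noteq> 0"
      using elim by (auto simp: field_simps)
    then show ?case by (simp add: field_simps)
  qed
  ultimately have "((\<lambda>\<xi>. D \<xi> / (K * l powr ((1 - a) / a) * y \<xi> powr ((1 - a) / a)))
      \<longlongrightarrow> K / K * 1) F"
    by (rule Lim_transform_eventually)
  then have "((\<lambda>\<xi>. D \<xi> / (K * l powr ((1 - a) / a) * y \<xi> powr ((1 - a) / a))) \<longlongrightarrow> 1) F"
    using K by simp
  from tendsto_rabs[OF this]
  show "sim_abs D (\<lambda>\<xi>. K * l powr ((1 - a) / a) * y \<xi> powr ((1 - a) / a)) F"
    by (simp add: sim_abs_def)
qed

lemma powr_profile_right:
  fixes W D :: "real \<Rightarrow> real"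
  assumes "0 < a" and W: "\<forall>\<^sub>F \<xi> in at_right x. 0 < W \<xi> \<and> (W has_real_derivative D \<xi>) (at \<xi>)"
    and W0: "(W \<longlongrightarrow> 0) (at_right x)"
    and D: "((\<lambda>\<xi>. D \<xi> * W \<xi> powr (a - 1)) \<longlongrightarrow> K) (at_right x)"
  shows "((\<lambda>\<xi>. W \<xi> powr a / (\<xi> - x)) \<longlongrightarrow> a * K) (at_right x)"
proof (rule lhopital_right[where f' = "\<lambda>\<xi>. a * (D \<xi> * W \<xi> powr (a - 1))" and g' = "\<lambda>_. 1"])
  show "((\<lambda>\<xi>. W \<xi> powr a) \<longlongrightarrow> 0) (at_right x)"
    by (rule tendsto_zero_powrI[OF W0 tendsto_const])
      (use W assms(1) in \<open>auto elim!: eventually_mono\<close>)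
  have "((\<lambda>\<xi>. \<xi> - x) \<longlongrightarrow> x - x) (at_right x)" by (intro tendsto_intros)
  then show "((\<lambda>\<xi>. \<xi> - x) \<longlongrightarrow> 0) (at_right x)" by simp
  show "\<forall>\<^sub>F \<xi> in at_right x. \<xi> - x \<noteq> 0"
    using eventually_at_right_less[of x] by eventually_elim simp
  show "\<forall>\<^sub>F \<xi> in at_right x. ((\<lambda>\<xi>. W \<xi> powr a) has_real_derivative
      a * (D \<xi> * W \<xi> powr (a - 1))) (at \<xi>)"
    using W by eventually_elim (use DERIV_fun_powr[of W] in \<open>force simp: mult_ac\<close>)
  show "((\<lambda>\<xi>. a * (D \<xi> * W \<xi> powr (a - 1)) / 1) \<longlongrightarrow> a * K) (at_right x)"
    using tendsto_mult_left[OF D] by simp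
qed (auto intro!: always_eventually derivative_eq_intros)

lemma powr_profile_left:
  fixes W D :: "real \<Rightarrow> real"
  assumes "0 < a" and W: "\<forall>\<^sub>F \<xi> in at_left x. 0 < W \<xi> \<and> (W has_real_derivative D \<xi>) (at \<xi>)"
    and W0: "(W \<longlongrightarrow> 0) (at_left x)"
    and D: "((\<lambda>\<xi>. D \<xi> * W \<xi> powr (a - 1)) \<longlongrightarrow> K) (at_left x)"
  shows "((\<lambda>\<xi>. W \<xi> powr a / (x - \<xi>)) \<longlongrightarrow> - a * K) (at_left x)"
proof (rule lhopital_left[where f' = "\<lambda>\<xi>. a * (D \<xi> * W \<xi> powr (a - 1))" and g' = "\<lambda>_. - 1"])
  show "((\<lambda>\<xi>. W \<xi> powr a) \<longlongrightarrow> 0) (at_left x)"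
    by (rule tendsto_zero_powrI[OF W0 tendsto_const])
      (use W assms(1) in \<open>auto elim!: eventually_mono\<close>)
  have "((\<lambda>\<xi>. x - \<xi>) \<longlongrightarrow> x - x) (at_left x)" by (intro tendsto_intros)
  then show "((\<lambda>\<xi>. x - \<xi>) \<longlongrightarrow> 0) (at_left x)" by simp
  show "\<forall>\<^sub>F \<xi> in at_left x. x - \<xi> \<noteq> 0"
    by (auto simp: eventually_at_filter)
  show "\<forall>\<^sub>F \<xi> in at_left x. ((\<lambda>\<xi>. W \<xi> powr a) has_real_derivative
      a * (D \<xi> * W \<xi> powr (a - 1))) (at \<xi>)"
    using W by eventually_elim (use DERIV_fun_powr[of W] in \<open>force simp: mult_ac\<close>)
  show "((\<lambda>\<xi>. a * (D \<xi> * W \<xi> powr (a - 1)) / - 1) \<longlongrightarrow> - a * K) (at_left x)"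
    using tendsto_minus[OF tendsto_mult_left[OF D]] by simp
qed (auto intro!: always_eventually derivative_eq_intros)

text \<open>This form of L'Hopital's rule only asks the denominator to diverge, so no limit of
  \<open>W\<close> enters.\<close>

lemma powr_profile_at_top:
  fixes W D :: "real \<Rightarrow> real"
  assumes W: "\<forall>\<^sub>F \<xi> in at_top. 0 < W \<xi> \<and> (W has_real_derivative D \<xi>) (at \<xi>)"
    and D: "((\<lambda>\<xi>. D \<xi> * W \<xi> powr (a - 1)) \<longlongrightarrow> K) at_top"
  shows "((\<lambda>\<xi>. W \<xi> powr a / \<xi>) \<longlongrightarrow> a * K) at_top"
proof (rule lhospital_at_top_at_top[where f' = "\<lambda>\<xi>. a * (D \<xi> * W \<xi> powr (a - 1))"
      and g' = "\<lambda>_. 1"])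
  show "\<forall>\<^sub>F \<xi> in at_top. ((\<lambda>\<xi>. W \<xi> powr a) has_real_derivative
      a * (D \<xi> * W \<xi> powr (a - 1))) (at \<xi>)"
    using W by eventually_elim (use DERIV_fun_powr[of W] in \<open>force simp: mult_ac\<close>)
  show "((\<lambda>\<xi>. a * (D \<xi> * W \<xi> powr (a - 1)) / 1) \<longlongrightarrow> a * K) at_top"
    using tendsto_mult_left[OF D] by simp
qed (auto simp: filterlim_ident)

lemma continuous_on_IciI:
  fixes f :: "real \<Rightarrow> real"
  assumes "(f \<longlongrightarrow> f a) (at_right a)" "\<And>x. a < x \<Longrightarrow> isCont f x"
  shows "continuous_on {a..} f"
  unfolding continuous_on_def
proof
  fix x assume "x \<in> {a..}"
  then consider "x = a" | "a < x" by fastforce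
  then show "(f \<longlongrightarrow> f x) (at x within {a..})"
  proof cases
    case 1
    have "at a within {a..} = at_right a"
      by (auto simp: filter_eq_iff eventually_at_filter elim!: eventually_mono)
    then show ?thesis using assms(1) 1 by simp
  next
    case 2
    then show ?thesis using assms(2)[of x] unfolding isCont_def
      by (blast intro: tendsto_within_subset)
  qed
qed

text \<open>The slope behaves like \<open>K * W powr (1 - a)\<close> with \<open>W\<close> tending
  to 0, so comparing \<open>a\<close> with 1 decides it. With \<open>a = m - 1\<close> this is the
  source of the cases \<open>m < 2\<close>, \<open>m = 2\<close> and \<open>m > 2\<close>.\<close>

lemma powr_profile_slope:
  fixes W D :: "'b \<Rightarrow> real"
  assumes pos: "\<forall>\<^sub>F \<xi> in F. 0 < W \<xi>" and W0: "(W \<longlongrightarrow> 0) F"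
    and D: "((\<lambda>\<xi>. D \<xi> * W \<xi> powr (a - 1)) \<longlongrightarrow> K) F"
  shows "1 < a \<Longrightarrow> 0 < K \<Longrightarrow> filterlim D at_top F"
    and "1 < a \<Longrightarrow> K < 0 \<Longrightarrow> filterlim D at_bot F"
    and "a = 1 \<Longrightarrow> (D \<longlongrightarrow> K) F"
    and "a < 1 \<Longrightarrow> (D \<longlongrightarrow> 0) F"
proof -
  have eq: "\<forall>\<^sub>F \<xi> in F. D \<xi> * W \<xi> powr (a - 1) * W \<xi> powr (1 - a) = D \<xi>"
    using pos by eventually_elim (simp add: mult.assoc flip: powr_add)
  have blowup: "filterlim (\<lambda>\<xi>. W \<xi> powr (1 - a)) at_top F" if "1 < a"
  proof -
    have "((\<lambda>\<xi>. W \<xi> powr (a - 1)) \<longlongrightarrow> 0) F"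
      by (rule tendsto_zero_powrI[OF W0 tendsto_const])
        (use pos that in \<open>auto elim!: eventually_mono\<close>)
    moreover have "\<forall>\<^sub>F \<xi> in F. 0 < W \<xi> powr (a - 1)"
      using pos by eventually_elim simp
    ultimately have "filterlim (\<lambda>\<xi>. inverse (W \<xi> powr (a - 1))) at_top F"
      by (rule filterlim_inverse_at_top)
    then show ?thesis by (simp flip: powr_minus)
  qed
  show "filterlim D at_top F" if "1 < a" "0 < K"
    using filterlim_tendsto_pos_mult_at_top[OF D that(2) blowup[OF that(1)]]
      filterlim_cong[OF refl refl eq] by blast
  show "filterlim D at_bot F" if "1 < a" "K < 0"
    using filterlim_tendsto_neg_mult_at_bot[OF D that(2) blowup[OF that(1)]]
      filterlim_cong[OF refl refl eq] by blast
  show "(D \<longlongrightarrow> K) F" if "a = 1"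
  proof -
    have "\<forall>\<^sub>F \<xi> in F. D \<xi> * W \<xi> powr (a - 1) = D \<xi>"
      using pos by eventually_elim (simp add: that)
    with D show ?thesis by (rule Lim_transform_eventually)
  qed
  show "(D \<longlongrightarrow> 0) F" if "a < 1"
  proof -
    have "((\<lambda>\<xi>. W \<xi> powr (1 - a)) \<longlongrightarrow> 0) F"
      by (rule tendsto_zero_powrI[OF W0 tendsto_const])
        (use pos that in \<open>auto elim!: eventually_mono\<close>)
    from Lim_transform_eventually[OF tendsto_mult[OF D this] eq] show ?thesis by simp
  qed
qed

lemma left_end_asympI:
  assumes m: "0 < m"
    and W: "\<forall>\<^sub>F \<xi> in at_right x. 0 < W \<xi> \<and> (W has_real_derivative deriv W \<xi>) (at \<xi>)"
    and W0: "(W \<longlongrightarrow> 0) (at_right x)"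
    and D: "((\<lambda>\<xi>. deriv W \<xi> * W \<xi> powr (m - 1)) \<longlongrightarrow> K) (at_right x)" and K: "0 < K"
  shows "left_end_asymp m x W"
proof -
  have l: "0 < m * K" using m K by simp
  have pos: "\<forall>\<^sub>F \<xi> in at_right x. 0 < W \<xi> \<and> 0 < \<xi> - x"
    using W eventually_at_right_less[of x] by eventually_elim simp
  have e: "(1 - m) / m = - ((m - 1) / m)" by (simp add: minus_divide_left)
  note * = sim_abs_powr_profile[OF _ pos powr_profile_right[OF m W W0 D] l D]
  show ?thesis
    unfolding left_end_asymp_def
  proof (intro exI conjI)
    show "sim_abs W (\<lambda>\<xi>. (m * K) powr (1 / m) * (\<xi> - x) powr (1 / m)) (at_right x)"
      "sim_abs (deriv W) (\<lambda>\<xi>. K * (m * K) powr ((1 - m) / m) * (\<xi> - x) powr - ((m - 1) / m))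
         (at_right x)"
      using * m K unfolding e by auto
  qed (use m K in auto)
qed

text \<open>Serves both kinds of right end: \<open>a = m\<close> for quenching,
  \<open>a = m - 1\<close> for the singularity.\<close>

lemma sim_abs_left_endE:
  assumes a: "0 < a"
    and W: "\<forall>\<^sub>F \<xi> in at_left x. 0 < W \<xi> \<and> (W has_real_derivative deriv W \<xi>) (at \<xi>)"
    and W0: "(W \<longlongrightarrow> 0) (at_left x)"
    and D: "((\<lambda>\<xi>. deriv W \<xi> * W \<xi> powr (a - 1)) \<longlongrightarrow> K) (at_left x)" and K: "K < 0"
  obtains A B where "0 < A" "0 < B"
    "sim_abs W (\<lambda>\<xi>. A * (x - \<xi>) powr (1 / a)) (at_left x)"
    "sim_abs (deriv W) (\<lambda>\<xi>. - B * (x - \<xi>) powr (- ((a - 1) / a))) (at_left x)"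
proof -
  have l: "0 < - a * K" using a K by (simp add: mult_less_0_iff)
  have "\<forall>\<^sub>F \<xi> in at_left x. \<xi> < x" by (auto simp: eventually_at_filter)
  with W have pos: "\<forall>\<^sub>F \<xi> in at_left x. 0 < W \<xi> \<and> 0 < x - \<xi>"
    by eventually_elim simp
  have e: "(1 - a) / a = - ((a - 1) / a)" by (simp add: minus_divide_left)
  note * = sim_abs_powr_profile[OF _ pos powr_profile_left[OF a W W0 D] l D]
  show thesis
  proof (rule that)
    show "sim_abs W (\<lambda>\<xi>. (- a * K) powr (1 / a) * (x - \<xi>) powr (1 / a)) (at_left x)"
      "sim_abs (deriv W) (\<lambda>\<xi>. - (- K * (- a * K) powr ((1 - a) / a)) * (x - \<xi>) powr - ((a - 1) / a))
         (at_left x)"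
      using * a K unfolding e by auto
  qed (use a K l in \<open>auto simp: mult_less_0_iff\<close>)
qed

section \<open>Return to the travelling-wave variable\<close>

text \<open>\<open>P\<close> is the flux, the derivative of \<open>W powr m\<close>, and the
  second-order equation is a first-order system for \<open>W\<close> and \<open>P\<close>. Its
  quotient-rule formula \<open>E\<close> for the second derivative of \<open>W\<close> is continuous
  because \<open>W\<close> stays positive on \<open>J\<close>.\<close>

lemma (in wave_params) quasi_tw_onI:
  assumes J: "open J" and pos: "\<And>\<xi>. \<xi> \<in> J \<Longrightarrow> 0 < W \<xi>"
    and dW: "\<And>\<xi>. \<xi> \<in> J \<Longrightarrow> (W has_real_derivative P \<xi> / (m * W \<xi> powr (m - 1))) (at \<xi>)"
    and dP: "\<And>\<xi>. \<xi> \<in> J \<Longrightarrow>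
      (P has_real_derivative - c * (P \<xi> / (m * W \<xi> powr (m - 1))) - \<mu> * W \<xi> powr m) (at \<xi>)"
  shows "quasi_tw_on m \<mu> c W J"
proof -
  define D where "D \<xi> = P \<xi> / (m * W \<xi> powr (m - 1))" for \<xi>
  define E where "E \<xi> = ((- c * D \<xi> - \<mu> * W \<xi> powr m) * (m * W \<xi> powr (m - 1))
      - P \<xi> * (m * ((m - 1) * W \<xi> powr (m - 1 - of_nat 1) * D \<xi>)))
      / ((m * W \<xi> powr (m - 1)) * (m * W \<xi> powr (m - 1)))" for \<xi>
  have dD: "(D has_real_derivative E \<xi>) (at \<xi>)" if "\<xi> \<in> J" for \<xi>
    unfolding D_def[abs_def] E_def
    by (rule DERIV_divide DERIV_cmult DERIV_fun_powr dW dP that pos)+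
      (use m pos[OF that] in \<open>auto simp: D_def[symmetric] intro: dP that\<close>)
  have derivW: "deriv W \<xi> = D \<xi>" if "\<xi> \<in> J" for \<xi>
    using dW[OF that] by (simp add: D_def DERIV_imp_deriv)
  have ddW: "(deriv W has_real_derivative E \<xi>) (at \<xi>)" if "\<xi> \<in> J" for \<xi>
    using has_field_derivative_transform_within_open[OF dD[OF that] J that] derivW by auto
  have cont: "continuous_on J W" "continuous_on J P"
    using dW dP by (blast intro: continuous_at_imp_continuous_on DERIV_isCont)+
  have "continuous_on J D"
    using dD by (blast intro: continuous_at_imp_continuous_on DERIV_isCont)
  then have "continuous_on J E"
    unfolding E_def using pos m by (intro continuous_intros cont) (auto simp: less_imp_neq[symmetric])
  moreover have "deriv (deriv W) \<xi> = E \<xi>" if "\<xi> \<in> J" for \<xi>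
    using ddW[OF that] by (rule DERIV_imp_deriv)
  ultimately have "continuous_on J (deriv (deriv W))"
    by (simp cong: continuous_on_cong)
  then have C2: "C2_on W J"
    unfolding C2_on_def using dW ddW by (auto simp: real_differentiable_def)
  have dWm: "((\<lambda>x. W x powr m) has_real_derivative P \<xi>) (at \<xi>)" if "\<xi> \<in> J" for \<xi>
  proof -
    have "((\<lambda>x. W x powr m) has_real_derivative
        m * W \<xi> powr (m - of_nat 1) * (P \<xi> / (m * W \<xi> powr (m - 1)))) (at \<xi>)"
      by (rule DERIV_fun_powr[OF dW[OF that] pos[OF that]])
    then show ?thesis using m pos[OF that] by simp
  qed
  have ddWm: "(deriv (\<lambda>x. W x powr m) has_real_derivative
      - c * (P \<xi> / (m * W \<xi> powr (m - 1))) - \<mu> * W \<xi> powr m) (at \<xi>)" if "\<xi> \<in> J" for \<xi>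
    by (rule has_field_derivative_transform_within_open[OF dP[OF that] J that])
      (simp add: DERIV_imp_deriv[OF dWm])
  show ?thesis
    unfolding quasi_tw_on_def
  proof (intro conjI ballI)
    fix \<xi> assume \<xi>: "\<xi> \<in> J"
    show "0 \<le> W \<xi>" using pos[OF \<xi>] by simp
    show "(\<lambda>x. W x powr m) differentiable at \<xi>" "deriv (\<lambda>x. W x powr m) differentiable at \<xi>"
      using dWm[OF \<xi>] ddWm[OF \<xi>] unfolding real_differentiable_def by blast+
    show "- c * deriv W \<xi> = deriv (deriv (\<lambda>x. W x powr m)) \<xi> + \<mu> * W \<xi> powr m"
      by (simp add: DERIV_imp_deriv[OF ddWm[OF \<xi>]] derivW[OF \<xi>] D_def)
  qed (fact C2)
qed

text \<open>The \<open>max\<close> extends the rate beyond the zeros of \<open>V\<close>, so that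
  the clock is defined and differentiable at the end times too.\<close>

lemma (in orbit) clock_exists:
  obtains X where "X 0 = 0"
    "\<And>t. (X has_real_derivative m * max 0 (V t) powr (m - 1)) (at t)"
proof -
  have "continuous_on UNIV (\<lambda>t. m * max 0 (V t) powr (m - 1))"
    using m by (intro continuous_intros continuous_on_powr' contV) auto
  then obtain X where "X 0 = 0"
      "\<And>t. (X has_vector_derivative m * max 0 (V t) powr (m - 1)) (at t)"
    using continuous_antiderivative by blast
  then show thesis
    by (intro that[of X]) (simp_all add: has_real_derivative_iff_has_vector_derivative)
qed

text \<open>\<open>X\<close> is the coordinate \<xi> as a function of time, and \<open>Q\<close> the
  set of times that carry the profile. Keeping \<open>Q\<close> abstract lets bounded and
  half-infinite time intervals share the lemmas.\<close>

locale clock = orbit +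
  fixes X :: "real \<Rightarrow> real" and Q :: "real set"
  assumes X0: "X 0 = 0"
    and dX: "(X has_real_derivative m * max 0 (V t) powr (m - 1)) (at t)"
    and Q: "0 \<in> Q" "open Q" "t \<in> Q \<Longrightarrow> 0 < V t"
begin

definition J :: "real set" where "J = X ` Q"

lemma contX: "continuous_on S X"
  using dX by (blast intro: continuous_at_imp_continuous_on DERIV_isCont)

lemma X_less:
  assumes "s < t" "0 \<le> V s" "0 \<le> V t"
  shows "X s < X t"
proof (rule DERIV_pos_imp_increasing_open[OF assms(1)])
  fix x assume x: "s < x" "x < t"
  have "0 < V x"
  proof (cases "x \<le> 0")
    case True
    then show ?thesis using V_increasing[of x s] x assms by simp
  next
    case False
    then show ?thesis using V_decreasing[of x t] x assms by simp
  qed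
  then show "\<exists>y. (X has_real_derivative y) (at x) \<and> 0 < y"
    using dX[of x] m by (intro exI[of _ "m * max 0 (V x) powr (m - 1)"] conjI) auto
qed (rule contX)

lemma X_inj: "inj_on X Q"
proof (rule inj_onI)
  fix s t assume "s \<in> Q" "t \<in> Q" "X s = X t"
  then show "s = t"
    using X_less[of s t] X_less[of t s] Q(3)[of s] Q(3)[of t]
    by (cases s t rule: linorder_cases) auto
qed

lemma open_J: "open J"
  unfolding J_def
  by (rule injective_into_1d_imp_open_map_UNIV[OF Q(2) contX X_inj subset_refl])

definition T :: "real \<Rightarrow> real" where "T = the_inv_into Q X"

lemma TX: "t \<in> Q \<Longrightarrow> T (X t) = t"
  unfolding T_def by (rule the_inv_into_f_f[OF X_inj])

lemma X_in_J: "t \<in> Q \<Longrightarrow> X t \<in> J"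
  by (simp add: J_def)

lemma T_in_Q: "\<xi> \<in> J \<Longrightarrow> T \<xi> \<in> Q" and XT: "\<xi> \<in> J \<Longrightarrow> X (T \<xi>) = \<xi>"
  using TX by (force simp: J_def)+

lemma T_less: "\<xi> \<in> J \<Longrightarrow> \<eta> \<in> J \<Longrightarrow> \<xi> < \<eta> \<Longrightarrow> T \<xi> < T \<eta>"
  using X_less[of "T \<eta>" "T \<xi>"] Q(3)[OF T_in_Q[of \<xi>]] Q(3)[OF T_in_Q[of \<eta>]] XT[of \<xi>] XT[of \<eta>]
  by (cases "T \<xi>" "T \<eta>" rule: linorder_cases) auto

lemma T0: "T 0 = 0" "0 \<in> J"
  using TX[of 0] X_in_J[of 0] Q X0 by auto

lemma dT: "(T has_real_derivative inverse (m * V (T \<xi>) powr (m - 1))) (at \<xi>)" if "\<xi> \<in> J"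
proof -
  have "0 < V (T \<xi>)" using Q(3) T_in_Q that by blast
  then have "(X has_real_derivative m * V (T \<xi>) powr (m - 1)) (at (T \<xi>))"
    and "m * V (T \<xi>) powr (m - 1) \<noteq> 0"
    using dX[of "T \<xi>"] m by auto
  then have "(T has_derivative (*) (inverse (m * V (T \<xi>) powr (m - 1)))) (at \<xi>)"
    unfolding has_field_derivative_def
    by (intro has_derivative_inverse_strong_x[of Q T \<xi> X] Q(2) contX T_in_Q XT TX that)
      (auto simp: fun_eq_iff field_simps)
  then show ?thesis by (simp add: has_field_derivative_def)
qed

text \<open>The value 0 off \<open>J\<close> makes \<open>W\<close> its own zero extension, so one
  function is both the quasi and the weak travelling wave.\<close>

definition W :: "real \<Rightarrow> real" where "W \<xi> = (if \<xi> \<in> J then V (T \<xi>) else 0)"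

lemma W_pos: "\<xi> \<in> J \<Longrightarrow> 0 < W \<xi>"
  using Q(3) T_in_Q by (simp add: W_def)

lemma W_outside: "\<xi> \<notin> J \<Longrightarrow> W \<xi> = 0"
  by (simp add: W_def)

lemma dW: "(W has_real_derivative p (T \<xi>) / (m * W \<xi> powr (m - 1))) (at \<xi>)" if "\<xi> \<in> J"
proof -
  have "((\<lambda>\<xi>. V (T \<xi>)) has_real_derivative p (T \<xi>) * inverse (m * V (T \<xi>) powr (m - 1))) (at \<xi>)"
    by (rule DERIV_chain2[OF dV dT[OF that]])
  then have "((\<lambda>\<xi>. V (T \<xi>)) has_real_derivative p (T \<xi>) / (m * W \<xi> powr (m - 1))) (at \<xi>)"
    using that by (simp add: W_def divide_inverse)
  from has_field_derivative_transform_within_open[OF this open_J that] show ?thesis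
    by (simp add: W_def)
qed

lemma deriv_W: "\<xi> \<in> J \<Longrightarrow> deriv W \<xi> = p (T \<xi>) / (m * W \<xi> powr (m - 1))"
  using dW DERIV_imp_deriv by blast

lemma quasi_tw: "quasi_tw_on m \<mu> c W J"
proof (rule quasi_tw_onI[where P = "\<lambda>\<xi>. p (T \<xi>)"])
  fix \<xi> assume \<xi>: "\<xi> \<in> J"
  have "((\<lambda>\<xi>. p (T \<xi>)) has_real_derivative
      (- c * p (T \<xi>) - G R (V (T \<xi>))) * inverse (m * V (T \<xi>) powr (m - 1))) (at \<xi>)"
    by (rule DERIV_chain2[OF dp dT[OF \<xi>]])
  moreover have "(- c * p (T \<xi>) - G R (V (T \<xi>))) * inverse (m * V (T \<xi>) powr (m - 1))
      = - c * (p (T \<xi>) / (m * W \<xi> powr (m - 1))) - \<mu> * W \<xi> powr m"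
  proof -
    have pos: "0 < V (T \<xi>)" using Q(3) T_in_Q \<xi> by blast
    \<comment> \<open>Dividing by the clock rate cancels the factor
      \<open>m * V powr (m - 1)\<close> of the force and leaves the reaction term; this is where the
      exponent \<open>2 * m - 1\<close> comes from.\<close>
    have "V (T \<xi>) powr (2 * m - 1) = V (T \<xi>) powr m * V (T \<xi>) powr (m - 1)"
      by (simp flip: powr_add)
    then show ?thesis
      using pos m \<xi> by (simp add: G_V W_def field_simps)
  qed
  ultimately show "((\<lambda>\<xi>. p (T \<xi>)) has_real_derivative
      - c * (p (T \<xi>) / (m * W \<xi> powr (m - 1))) - \<mu> * W \<xi> powr m) (at \<xi>)"
    by simp
qed (use open_J W_pos dW in auto)

lemma positive_exactly: "positive_exactly_on W J"
  using W_pos W_outside by (auto simp: positive_exactly_on_def)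

lemma single_peak: "single_peak_on W J"
  unfolding single_peak_on_def
proof (rule bexI[of _ 0], intro conjI ballI impI)
  have d: "0 < m * W \<xi> powr (m - 1)" if "\<xi> \<in> J" for \<xi>
    using W_pos[OF that] m by simp
  show "0 < deriv W \<xi>" if "\<xi> \<in> J" "\<xi> < 0" for \<xi>
    using T_less[OF that(1) T0(2) that(2)] p_pos[of "T \<xi>"] d[OF that(1)]
    by (simp add: deriv_W that T0)
  show "deriv W \<xi> < 0" if "\<xi> \<in> J" "0 < \<xi>" for \<xi>
    using T_less[OF T0(2) that(1) that(2)] p_neg[of "T \<xi>"] d[OF that(1)]
    by (simp add: deriv_W that T0 divide_neg_pos)
  show "deriv W 0 = 0" by (simp add: deriv_W T0 p0)
qed (rule T0(2))

lemma peak: "W 0 = M" "W \<xi> \<le> M"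
  using V0 V_le_M M by (auto simp: W_def T0 less_imp_le)

lemma zero_extension_W: "zero_extension W J = W"
  by (auto simp: zero_extension_def W_outside)

text \<open>Translates the end behaviour into orbit ratios: \<open>a = m\<close> gives
  \<open>p / m\<close>, \<open>a = m - 1\<close> gives \<open>p / (m * V)\<close>, and
  \<open>a = 1 - m\<close> gives \<open>p / (m * V powr (2 * m - 1))\<close>.\<close>

lemma slope_powr:
  assumes "\<xi> \<in> J"
  shows "deriv W \<xi> * W \<xi> powr (a - 1) = p (T \<xi>) / (m * V (T \<xi>) powr (m - a))"
proof -
  have pos: "0 < V (T \<xi>)" using Q(3) T_in_Q assms by blast
  have "V (T \<xi>) powr (m - 1) = V (T \<xi>) powr (a - 1) * V (T \<xi>) powr (m - a)"
    by (simp flip: powr_add)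
  then show ?thesis using pos m assms by (simp add: deriv_W W_def field_simps)
qed

lemma end_limits:
  assumes T: "filterlim T F' F" and J: "\<forall>\<^sub>F \<xi> in F. \<xi> \<in> J"
  shows "\<forall>\<^sub>F \<xi> in F. 0 < W \<xi> \<and> (W has_real_derivative deriv W \<xi>) (at \<xi>)"
    and "(V \<longlongrightarrow> l) F' \<Longrightarrow> (W \<longlongrightarrow> l) F"
    and "((\<lambda>t. p t / (m * V t powr (m - a))) \<longlongrightarrow> K) F' \<Longrightarrow>
      ((\<lambda>\<xi>. deriv W \<xi> * W \<xi> powr (a - 1)) \<longlongrightarrow> K) F"
proof -
  show "\<forall>\<^sub>F \<xi> in F. 0 < W \<xi> \<and> (W has_real_derivative deriv W \<xi>) (at \<xi>)"
    using J by eventually_elim (use W_pos dW deriv_W in auto)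
  show "(W \<longlongrightarrow> l) F" if "(V \<longlongrightarrow> l) F'"
  proof (rule Lim_transform_eventually[OF filterlim_compose[OF that T]])
    show "\<forall>\<^sub>F \<xi> in F. V (T \<xi>) = W \<xi>" using J by eventually_elim (simp add: W_def)
  qed
  show "((\<lambda>\<xi>. deriv W \<xi> * W \<xi> powr (a - 1)) \<longlongrightarrow> K) F"
    if "((\<lambda>t. p t / (m * V t powr (m - a))) \<longlongrightarrow> K) F'"
  proof (rule Lim_transform_eventually[OF filterlim_compose[OF that T]])
    show "\<forall>\<^sub>F \<xi> in F. p (T \<xi>) / (m * V (T \<xi>) powr (m - a)) = deriv W \<xi> * W \<xi> powr (a - 1)"
      using J by eventually_elim (simp add: slope_powr)
  qed
qed

lemma T_lessI: "\<xi> \<in> J \<Longrightarrow> t \<in> Q \<Longrightarrow> \<xi> < X t \<Longrightarrow> T \<xi> < t"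
  and T_greaterI: "\<xi> \<in> J \<Longrightarrow> t \<in> Q \<Longrightarrow> X t < \<xi> \<Longrightarrow> t < T \<xi>"
  using T_less[of \<xi> "X t"] T_less[of "X t" \<xi>] X_in_J[of t] TX[of t] by auto

text \<open>Only the part of \<open>Q\<close> near \<open>a\<close> is prescribed, so the lemma
  applies whatever happens at the other end.\<close>

lemma T_left_end:
  assumes a: "a < 0" "V a = 0" "{a<..0} \<subseteq> Q" "Q \<subseteq> {a<..}" and J': "{X a<..<0} \<subseteq> J"
  shows "filterlim T (at_right a) (at_right (X a))" "\<forall>\<^sub>F \<xi> in at_right (X a). \<xi> \<in> J"
proof -
  have "X a < 0" using X_less[of a 0] a V0 M X0 by simp
  then have "\<forall>\<^sub>F \<xi> in at_right (X a). \<xi> \<in> {X a<..<0}"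
    by (intro eventually_at_right_real)
  then show ev: "\<forall>\<^sub>F \<xi> in at_right (X a). \<xi> \<in> J"
    by eventually_elim (use J' in auto)
  have "(T \<longlongrightarrow> a) (at_right (X a))"
  proof (rule order_tendstoI)
    show "\<forall>\<^sub>F \<xi> in at_right (X a). l < T \<xi>" if "l < a" for l
      using ev by eventually_elim (use T_in_Q a that in force)
    fix u assume "a < u"
    then have u: "a < min u 0" "min u 0 \<in> Q" using a by (auto simp: min_def)
    then have "X a < X (min u 0)" using X_less[of a "min u 0"] a Q(3)[of "min u 0"] by simp
    then have "\<forall>\<^sub>F \<xi> in at_right (X a). \<xi> \<in> {X a<..<X (min u 0)}"
      by (intro eventually_at_right_real)
    with ev show "\<forall>\<^sub>F \<xi> in at_right (X a). T \<xi> < u"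
      by eventually_elim (use T_lessI u in fastforce)
  qed
  moreover have "\<forall>\<^sub>F \<xi> in at_right (X a). T \<xi> \<in> {a<..} \<and> T \<xi> \<noteq> a"
    using ev by eventually_elim (use T_in_Q a in force)
  ultimately show "filterlim T (at_right a) (at_right (X a))"
    by (auto simp: filterlim_at)
qed

lemma T_right_end:
  assumes b: "0 < b" "V b = 0" "{0..<b} \<subseteq> Q" "Q \<subseteq> {..<b}" and J': "{0<..<X b} \<subseteq> J"
  shows "filterlim T (at_left b) (at_left (X b))" "\<forall>\<^sub>F \<xi> in at_left (X b). \<xi> \<in> J"
proof -
  have "0 < X b" using X_less[of 0 b] b V0 M X0 by simp
  then have "\<forall>\<^sub>F \<xi> in at_left (X b). \<xi> \<in> {0<..<X b}"
    by (intro eventually_at_left_real)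
  then show ev: "\<forall>\<^sub>F \<xi> in at_left (X b). \<xi> \<in> J"
    by eventually_elim (use J' in auto)
  have "(T \<longlongrightarrow> b) (at_left (X b))"
  proof (rule order_tendstoI)
    show "\<forall>\<^sub>F \<xi> in at_left (X b). T \<xi> < l" if "b < l" for l
      using ev by eventually_elim (use T_in_Q b that in force)
    fix u assume "u < b"
    then have u: "max u 0 < b" "max u 0 \<in> Q" using b by (auto simp: max_def)
    then have "X (max u 0) < X b" using X_less[of "max u 0" b] b Q(3)[of "max u 0"] by simp
    then have "\<forall>\<^sub>F \<xi> in at_left (X b). \<xi> \<in> {X (max u 0)<..<X b}"
      by (intro eventually_at_left_real)
    with ev show "\<forall>\<^sub>F \<xi> in at_left (X b). u < T \<xi>"
      by eventually_elim (use T_greaterI u in fastforce)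
  qed
  moreover have "\<forall>\<^sub>F \<xi> in at_left (X b). T \<xi> \<in> {..<b} \<and> T \<xi> \<noteq> b"
    using ev by eventually_elim (use T_in_Q b in force)
  ultimately show "filterlim T (at_left b) (at_left (X b))"
    by (auto simp: filterlim_at)
qed

text \<open>\<open>F\<close> will be \<open>at_left x\<close> when the clock converges to
  \<open>x\<close>, and \<open>at_top\<close> when it diverges.\<close>

lemma T_at_top:
  assumes Q': "{0..} \<subseteq> Q" and ev: "\<forall>\<^sub>F \<xi> in F. \<xi> \<in> J"
    and large: "\<And>t. 0 \<le> t \<Longrightarrow> \<forall>\<^sub>F \<xi> in F. X t < \<xi>"
  shows "filterlim T at_top F"
  unfolding filterlim_at_top
proof
  fix t
  have t: "max t 0 \<in> Q" using Q' by auto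
  from ev large[of "max t 0", simplified] show "\<forall>\<^sub>F \<xi> in F. t \<le> T \<xi>"
    by eventually_elim (use T_greaterI[OF _ t] in force)
qed

lemma X_Q_interval:
  assumes "a \<le> b" "0 \<le> V a" "0 \<le> V b" "X a \<le> y" "y \<le> X b"
  obtains t where "a \<le> t" "t \<le> b" "X t = y"
  using IVT'[of X a y b] assms contX by auto

lemma J_finite:
  assumes "V a = 0" "V b = 0" and Q': "Q = {a<..<b}"
  shows "J = {X a<..<X b}"
proof
  show "J \<subseteq> {X a<..<X b}"
  proof
    fix y assume "y \<in> J"
    then obtain t where t: "a < t" "t < b" "y = X t" using Q' unfolding J_def by auto
    moreover from this have "0 < V t" using Q(3)[of t] Q' by simp
    ultimately show "y \<in> {X a<..<X b}"
      using X_less[of a t] X_less[of t b] assms by simp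
  qed
  show "{X a<..<X b} \<subseteq> J"
  proof
    fix y assume y: "y \<in> {X a<..<X b}"
    then obtain t where "a \<le> t" "t \<le> b" "X t = y"
      using X_Q_interval[of a b y] assms Q(1) by auto
    moreover have "t \<noteq> a" "t \<noteq> b" using y \<open>X t = y\<close> by auto
    ultimately show "y \<in> J" using Q' unfolding J_def by auto
  qed
qed

text \<open>The right end is described through the values of \<open>X\<close>, since it is finite or
  infinite depending on the direction of approach to the origin.\<close>

lemma J_half:
  assumes "V a = 0" and Q': "Q = {a<..}"
  shows "J = {y. X a < y \<and> (\<exists>t\<ge>0. y < X t)}"
proof (intro equalityI subsetI)
  fix y assume "y \<in> J"
  then obtain t where t: "a < t" "y = X t" using Q' unfolding J_def by auto
  have "0 < V s" if "a < s" for s using Q(3)[of s] Q' that by simp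
  \<comment> \<open>\<open>max 0 t + 1\<close> is a nonnegative time strictly after
    \<open>t\<close>.\<close>
  from this[of t] this[of "max 0 t + 1"] have "X a < X t" "X t < X (max 0 t + 1)"
    using X_less[of a t] X_less[of t "max 0 t + 1"] t assms by (auto simp: max_def)
  then show "y \<in> {y. X a < y \<and> (\<exists>t\<ge>0. y < X t)}"
    using t by (auto intro!: exI[of _ "max 0 t + 1"])
next
  fix y assume "y \<in> {y. X a < y \<and> (\<exists>t\<ge>0. y < X t)}"
  then obtain b where y: "X a < y" "0 \<le> b" "y < X b" by blast
  have b: "a < b" "0 < V b" using Q(1) Q(3)[of b] Q' y by auto
  then obtain t where "a \<le> t" "X t = y"
    using X_Q_interval[of a b y] y assms(1) by auto
  moreover have "t \<noteq> a" using y \<open>X t = y\<close> by auto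
  ultimately show "y \<in> J" using Q' unfolding J_def by auto
qed

section \<open>Behaviour of the profile at each kind of end\<close>

lemma left_end:
  assumes a: "a < 0" "V a = 0" "0 < p a" "{a<..0} \<subseteq> Q" "Q \<subseteq> {a<..}" and J': "{X a<..<0} \<subseteq> J"
  shows "(W \<longlongrightarrow> 0) (at_right (X a))" "filterlim (deriv W) at_top (at_right (X a))"
    "left_end_asymp m (X a) W" "quenches W (at_right (X a))"
proof -
  note lims = end_limits[OF T_left_end[OF a(1,2,4,5) J']]
  have V: "(V \<longlongrightarrow> 0) (at_right a)"
    using DERIV_isCont[OF dV[of a]] a(2) unfolding isCont_def by (auto intro: tendsto_within_subset)
  then show W: "(W \<longlongrightarrow> 0) (at_right (X a))" by (rule lims)
  have "isCont p a" using dp by (rule DERIV_isCont)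
  then have "((\<lambda>t. p t / m) \<longlongrightarrow> p a / m) (at_right a)"
    using m unfolding isCont_def by (intro tendsto_intros) (auto intro: tendsto_within_subset)
  \<comment> \<open>Positivity of \<open>V\<close> matters here: \<open>0 powr 0\<close> is 0, so
    the exponent \<open>m - m\<close> gives the factor 1 only away from zeros.\<close>
  moreover have "\<forall>\<^sub>F t in at_right a. p t / m = p t / (m * V t powr (m - m))"
  proof -
    have "\<forall>\<^sub>F t in at_right a. t \<in> {a<..<0}" using a by (intro eventually_at_right_real)
    then show ?thesis
    proof eventually_elim
      case (elim t)
      then have "t \<in> Q" using a(4) by auto
      then have "0 < V t" by (rule Q(3))
      then show ?case by simp
    qed
  qed
  ultimately have "((\<lambda>t. p t / (m * V t powr (m - m))) \<longlongrightarrow> p a / m) (at_right a)"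
    by (rule Lim_transform_eventually)
  then have D: "((\<lambda>\<xi>. deriv W \<xi> * W \<xi> powr (m - 1)) \<longlongrightarrow> p a / m) (at_right (X a))"
    by (rule lims)
  have K: "0 < p a / m" using a m by simp
  show "left_end_asymp m (X a) W"
    using left_end_asympI[OF _ lims(1) W D K] m by simp
  have pos: "\<forall>\<^sub>F \<xi> in at_right (X a). 0 < W \<xi>"
    using lims(1) by eventually_elim simp
  show top: "filterlim (deriv W) at_top (at_right (X a))"
    using powr_profile_slope(1)[OF pos W D m K] .
  then show "quenches W (at_right (X a))"
    using W filterlim_compose[OF filterlim_abs_real top] by (simp add: quenches_def)
qed

lemma right_end:
  assumes b: "0 < b" "V b = 0" "{0..<b} \<subseteq> Q" "Q \<subseteq> {..<b}" and J': "{0<..<X b} \<subseteq> J"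
  shows "(W \<longlongrightarrow> 0) (at_left (X b))" "filterlim (deriv W) at_bot (at_left (X b))"
    "\<exists>A3>0. \<exists>A4>0. sim_abs W (\<lambda>\<xi>. A3 * (X b - \<xi>) powr (1 / m)) (at_left (X b)) \<and>
      sim_abs (deriv W) (\<lambda>\<xi>. - A4 * (X b - \<xi>) powr (- ((m - 1) / m))) (at_left (X b))"
    "quenches W (at_left (X b))"
proof -
  note lims = end_limits[OF T_right_end[OF b J']]
  have V: "(V \<longlongrightarrow> 0) (at_left b)"
    using DERIV_isCont[OF dV[of b]] b(2) unfolding isCont_def by (auto intro: tendsto_within_subset)
  then show W: "(W \<longlongrightarrow> 0) (at_left (X b))" by (rule lims)
  have "isCont p b" using dp by (rule DERIV_isCont)
  then have "((\<lambda>t. p t / m) \<longlongrightarrow> p b / m) (at_left b)"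
    using m unfolding isCont_def by (intro tendsto_intros) (auto intro: tendsto_within_subset)
  moreover have "\<forall>\<^sub>F t in at_left b. p t / m = p t / (m * V t powr (m - m))"
  proof -
    have "\<forall>\<^sub>F t in at_left b. t \<in> {0<..<b}" using b by (intro eventually_at_left_real)
    then show ?thesis
    proof eventually_elim
      case (elim t)
      then have "t \<in> Q" using b(3) by auto
      then have "0 < V t" by (rule Q(3))
      then show ?case by simp
    qed
  qed
  ultimately have "((\<lambda>t. p t / (m * V t powr (m - m))) \<longlongrightarrow> p b / m) (at_left b)"
    by (rule Lim_transform_eventually)
  then have D: "((\<lambda>\<xi>. deriv W \<xi> * W \<xi> powr (m - 1)) \<longlongrightarrow> p b / m) (at_left (X b))"
    by (rule lims)
  have K: "p b / m < 0" using p_neg[OF b(1)] m by (simp add: divide_neg_pos)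
  have "0 < m" using m by simp
  from sim_abs_left_endE[OF this lims(1) W D K]
  show "\<exists>A3>0. \<exists>A4>0. sim_abs W (\<lambda>\<xi>. A3 * (X b - \<xi>) powr (1 / m)) (at_left (X b)) \<and>
      sim_abs (deriv W) (\<lambda>\<xi>. - A4 * (X b - \<xi>) powr (- ((m - 1) / m))) (at_left (X b))"
    by blast
  have pos: "\<forall>\<^sub>F \<xi> in at_left (X b). 0 < W \<xi>"
    using lims(1) by eventually_elim simp
  show bot: "filterlim (deriv W) at_bot (at_left (X b))"
    using powr_profile_slope(2)[OF pos W D m K] .
  have "filterlim (\<lambda>\<xi>. \<bar>- deriv W \<xi>\<bar>) at_top (at_left (X b))"
    by (intro filterlim_compose[OF filterlim_abs_real]
        filterlim_compose[OF filterlim_uminus_at_top_at_bot bot])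
  then show "quenches W (at_left (X b))"
    using W by (simp add: quenches_def)
qed

text \<open>The fast ratio says that \<open>W' * W powr (m - 2)\<close> tends to
  \<open>- c / m\<close>. The sign of \<open>m - 2\<close> then decides the slope, and at
  \<open>m = 2\<close> the limit itself is the slope.\<close>

lemma fast_end:
  assumes Q': "{0..} \<subseteq> Q" and J': "{0<..<x} \<subseteq> J" and x: "0 < x" "\<And>t. 0 \<le> t \<Longrightarrow> X t < x"
    and ratio: "((\<lambda>t. - p t / V t) \<longlongrightarrow> c) at_top"
  shows "(W \<longlongrightarrow> 0) (at_left x)" "singular_end_asymp m x W"
    "m < 2 \<Longrightarrow> (deriv W \<longlongrightarrow> 0) (at_left x)"
    "m = 2 \<Longrightarrow> (deriv W \<longlongrightarrow> - (c / 2)) (at_left x)"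
    "2 < m \<Longrightarrow> filterlim (deriv W) at_bot (at_left x)"
proof -
  have V: "0 < V t" if "0 \<le> t" for t using Q' Q(3)[of t] that by auto
  have "\<forall>\<^sub>F \<xi> in at_left x. \<xi> \<in> {0<..<x}" using x by (intro eventually_at_left_real)
  then have ev: "\<forall>\<^sub>F \<xi> in at_left x. \<xi> \<in> J" by eventually_elim (use J' in auto)
  have large: "\<forall>\<^sub>F \<xi> in at_left x. X t < \<xi>" if "0 \<le> t" for t
  proof -
    have "\<forall>\<^sub>F \<xi> in at_left x. \<xi> \<in> {X t<..<x}" using x that by (intro eventually_at_left_real)
    then show ?thesis by eventually_elim simp
  qed
  have "filterlim T at_top (at_left x)" by (rule T_at_top[OF Q' ev large])
  note lims = end_limits[OF this ev]
  show W: "(W \<longlongrightarrow> 0) (at_left x)" by (intro lims V_tendsto_0 V)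
  have "((\<lambda>t. - (- p t / V t) / m) \<longlongrightarrow> - c / m) at_top"
    using m by (intro tendsto_intros ratio) auto
  moreover have "\<forall>\<^sub>F t in at_top. - (- p t / V t) / m = p t / (m * V t powr (m - (m - 1)))"
    using eventually_ge_at_top[of 0] by eventually_elim (use V in \<open>simp add: less_imp_le\<close>)
  ultimately have "((\<lambda>t. p t / (m * V t powr (m - (m - 1)))) \<longlongrightarrow> - c / m) at_top"
    by (rule Lim_transform_eventually)
  then have D: "((\<lambda>\<xi>. deriv W \<xi> * W \<xi> powr (m - 1 - 1)) \<longlongrightarrow> - c / m) (at_left x)"
    by (rule lims)
  have K: "- c / m < 0" using c m by simp
  have m1: "0 < m - 1" using m by simp
  have e: "(m - 1 - 1) / (m - 1) = (m - 2) / (m - 1)" by simp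
  from sim_abs_left_endE[OF m1 lims(1) W D K] show "singular_end_asymp m x W"
    unfolding singular_end_asymp_def e by blast
  have pos: "\<forall>\<^sub>F \<xi> in at_left x. 0 < W \<xi>"
    using lims(1) by eventually_elim simp
  note slope = powr_profile_slope[OF pos W D]
  show "m < 2 \<Longrightarrow> (deriv W \<longlongrightarrow> 0) (at_left x)" using slope(4) by simp
  show "m = 2 \<Longrightarrow> (deriv W \<longlongrightarrow> - (c / 2)) (at_left x)" using slope(3) by simp
  show "2 < m \<Longrightarrow> filterlim (deriv W) at_bot (at_left x)" using slope(2) K by simp
qed

text \<open>Here \<open>a = 1 - m\<close> is negative: \<open>W powr (1 - m)\<close> grows linearly,
  with rate \<open>(1 - m) * - (\<mu> / c)\<close>.\<close>

lemma slow_end: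
  assumes Q': "{0..} \<subseteq> Q" and J': "{0<..} \<subseteq> J"
    and slow: "((\<lambda>t. p t / V t powr (2 * m - 1)) \<longlongrightarrow> - (m * \<mu> / c)) at_top"
  shows "(W \<longlongrightarrow> 0) at_top" "(deriv W \<longlongrightarrow> 0) at_top"
    "sim_abs W (\<lambda>\<xi>. ((m - 1) * \<mu> / c) powr (- (1 / (m - 1))) * \<xi> powr (- (1 / (m - 1)))) at_top"
    "sim_abs (deriv W) (\<lambda>\<xi>. - inverse (m - 1) * ((m - 1) * \<mu> / c) powr (- (1 / (m - 1)))
      * \<xi> powr (- (m / (m - 1)))) at_top"
proof -
  have V: "0 < V t" if "0 \<le> t" for t using Q' Q(3)[of t] that by auto
  have ev: "\<forall>\<^sub>F \<xi> in at_top. \<xi> \<in> J"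
    using eventually_gt_at_top[of 0] by eventually_elim (use J' in auto)
  note lims = end_limits[OF T_at_top[OF Q' ev eventually_gt_at_top] ev]
  show W: "(W \<longlongrightarrow> 0) at_top" by (intro lims V_tendsto_0 V)
  have "((\<lambda>t. p t / V t powr (2 * m - 1) / m) \<longlongrightarrow> - (m * \<mu> / c) / m) at_top"
    using m by (intro tendsto_intros slow) auto
  then have "((\<lambda>t. p t / (m * V t powr (m - (1 - m)))) \<longlongrightarrow> - (\<mu> / c)) at_top"
    using m by (simp add: mult.commute)
  then have D: "((\<lambda>\<xi>. deriv W \<xi> * W \<xi> powr (1 - m - 1)) \<longlongrightarrow> - (\<mu> / c)) at_top"
    by (rule lims)
  have pos: "\<forall>\<^sub>F \<xi> in at_top. 0 < W \<xi>"
    using lims(1) by eventually_elim simp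
  show "(deriv W \<longlongrightarrow> 0) at_top" using powr_profile_slope(4)[OF pos W D] m by simp
  define l where "l = (m - 1) * \<mu> / c"
  have l: "0 < l" "(1 - m) * - (\<mu> / c) = l"
    using m \<mu> c by (auto simp: l_def field_simps)
  have pos': "\<forall>\<^sub>F \<xi> in at_top. 0 < W \<xi> \<and> 0 < \<xi>"
    using pos eventually_gt_at_top[of 0] by eventually_elim simp
  have "1 - m \<noteq> 0" "- (\<mu> / c) \<noteq> 0" using m \<mu> c by auto
  note * = sim_abs_powr_profile[OF this(1) pos' powr_profile_at_top[OF lims(1) D, unfolded l(2)] l(1) D this(2)]
  have e: "1 / (1 - m) = - (1 / (m - 1))" "(1 - (1 - m)) / (1 - m) = - (m / (m - 1))"
    using m by (auto simp: field_simps)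
  show "sim_abs W (\<lambda>\<xi>. ((m - 1) * \<mu> / c) powr (- (1 / (m - 1))) * \<xi> powr (- (1 / (m - 1)))) at_top"
    using *(1) unfolding e l_def .
  \<comment> \<open>Splitting off one factor \<open>1 / l\<close> turns the coefficient
    \<open>- (\<mu> / c)\<close> into \<open>- inverse (m - 1)\<close>.\<close>
  have "- (m / (m - 1)) = - (1 / (m - 1)) - 1" using m by (simp add: field_simps)
  then have "l powr (- (m / (m - 1))) = l powr (- (1 / (m - 1))) / l"
    using l by (simp only: powr_diff) simp
  moreover have "- (\<mu> / c) / l = - inverse (m - 1)"
    using m \<mu> c by (simp add: l_def field_simps)
  ultimately have "- (\<mu> / c) * l powr (- (m / (m - 1))) = - inverse (m - 1) * l powr (- (1 / (m - 1)))"
    by (metis times_divide_eq_left times_divide_eq_right)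
  then show "sim_abs (deriv W) (\<lambda>\<xi>. - inverse (m - 1) * ((m - 1) * \<mu> / c) powr (- (1 / (m - 1)))
      * \<xi> powr (- (m / (m - 1)))) at_top"
    using *(2) unfolding e by (simp only: l_def)
qed

text \<open>The derivative of \<open>V powr (1 - m)\<close> is bounded by a multiple of \<open>X'\<close>.\<close>

lemma X_at_top:
  assumes Q': "{0..} \<subseteq> Q"
    and slow: "((\<lambda>t. p t / V t powr (2 * m - 1)) \<longlongrightarrow> - (m * \<mu> / c)) at_top"
  shows "filterlim X at_top at_top"
proof -
  have V: "0 < V t" if "0 \<le> t" for t using Q' Q(3)[of t] that by auto
  define K where "K = m * \<mu> / c + 1"
  have K: "0 < K" using m \<mu> c by (simp add: K_def add_pos_pos)
  have "\<forall>\<^sub>F t in at_top. - K < p t / V t powr (2 * m - 1)"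
    by (rule order_tendstoD(1)[OF slow]) (simp add: K_def)
  then obtain t0 where t0: "\<And>t. t0 \<le> t \<Longrightarrow> - K < p t / V t powr (2 * m - 1)"
    by (auto simp: eventually_at_top_linorder)
  define s where "s = max 0 t0"
  \<comment> \<open>With \<open>p \<ge> - K * V powr (2 * m - 1)\<close> the derivative of
    \<open>V powr (1 - m)\<close> is at most \<open>(m - 1) * K * V powr (m - 1)\<close>, and
    \<open>L\<close> makes this equal to \<open>L\<close> times the clock rate.\<close>
  define L where "L = (m - 1) * K / m"
  have L: "0 < L" "L * m = (m - 1) * K" using m K by (auto simp: L_def)
  have mono: "L * X s - V s powr (1 - m) \<le> L * X t - V t powr (1 - m)" if "s \<le> t" for t
  proof (rule DERIV_nonneg_imp_nondecreasing[OF that])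
    fix u assume u: "s \<le> u"
    then have Vu: "0 < V u" using V by (simp add: s_def)
    have "- K * V u powr (2 * m - 1) \<le> p u"
      using t0[of u] u Vu by (simp add: s_def field_simps)
    then have "(m - 1) * V u powr (- m) * (- K * V u powr (2 * m - 1)) \<le> (m - 1) * V u powr (- m) * p u"
      using m by (intro mult_left_mono) auto
    moreover have "(m - 1) * V u powr (- m) * (- K * V u powr (2 * m - 1)) = - ((m - 1) * K * V u powr (m - 1))"
    proof -
      have "V u powr (- m) * V u powr (2 * m - 1) = V u powr (m - 1)"
        by (simp flip: powr_add)
      then show ?thesis by (simp add: mult_ac)
    qed
    ultimately have "- ((m - 1) * K * V u powr (m - 1)) \<le> (m - 1) * V u powr (- m) * p u" by linarith
    moreover have "(m - 1) * K * V u powr (m - 1) = L * (m * max 0 (V u) powr (m - 1))"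
      unfolding L(2)[symmetric] using Vu by simp
    moreover have "(m - 1) * V u powr (- m) * p u = - ((1 - m) * V u powr (1 - m - of_nat 1) * p u)"
      by (simp add: algebra_simps)
    ultimately have "0 \<le> L * (m * max 0 (V u) powr (m - 1)) - (1 - m) * V u powr (1 - m - of_nat 1) * p u"
      by linarith
    moreover have "((\<lambda>t. L * X t - V t powr (1 - m)) has_real_derivative
        L * (m * max 0 (V u) powr (m - 1)) - (1 - m) * V u powr (1 - m - of_nat 1) * p u) (at u)"
      by (rule DERIV_diff DERIV_cmult dX DERIV_fun_powr dV Vu)+
    ultimately show "\<exists>l. ((\<lambda>t. L * X t - V t powr (1 - m)) has_real_derivative l) (at u) \<and> 0 \<le> l"
      by blast
  qed
  have "filterlim (\<lambda>t. inverse (V t powr (m - 1))) at_top at_top"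
  proof (rule filterlim_inverse_at_top)
    show "((\<lambda>t. V t powr (m - 1)) \<longlongrightarrow> 0) at_top" using V_powr_tendsto_0[OF V] m by simp
    show "\<forall>\<^sub>F t in at_top. 0 < V t powr (m - 1)"
      using eventually_ge_at_top[of 0] by eventually_elim (use V in force)
  qed
  then have "filterlim (\<lambda>t. V t powr (1 - m)) at_top at_top" by (simp flip: powr_minus)
  then have "filterlim (\<lambda>t. (L * X s - V s powr (1 - m)) + V t powr (1 - m)) at_top at_top"
    by (rule filterlim_tendsto_add_at_top[OF tendsto_const])
  then have "filterlim (\<lambda>t. inverse L * ((L * X s - V s powr (1 - m)) + V t powr (1 - m))) at_top at_top"
    using L by (intro filterlim_tendsto_pos_mult_at_top[OF tendsto_const]) auto
  then show ?thesis
  proof (rule filterlim_at_top_mono)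
    show "\<forall>\<^sub>F t in at_top. inverse L * ((L * X s - V s powr (1 - m)) + V t powr (1 - m)) \<le> X t"
      using eventually_ge_at_top[of s]
    proof eventually_elim
      case (elim t)
      then have "(L * X s - V s powr (1 - m)) + V t powr (1 - m) \<le> L * X t"
        using mono[OF elim] by linarith
      then show ?case using L by (simp add: field_simps)
    qed
  qed
qed

text \<open>The derivative of \<open>V powr (m - 1)\<close> is at most a negative multiple of \<open>X'\<close>.\<close>

lemma X_bounded:
  assumes Q': "{0..} \<subseteq> Q" and ratio: "((\<lambda>t. - p t / V t) \<longlongrightarrow> c) at_top"
  obtains B where "\<And>t. 0 \<le> t \<Longrightarrow> X t \<le> B"
proof -
  have V: "0 < V t" if "0 \<le> t" for t using Q' Q(3)[of t] that by auto
  have "\<forall>\<^sub>F t in at_top. c / 2 < - p t / V t"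
    using ratio c by (intro order_tendstoD(1)) auto
  then obtain t0 where t0: "\<And>t. t0 \<le> t \<Longrightarrow> c / 2 < - p t / V t"
    by (auto simp: eventually_at_top_linorder)
  define s where "s = max 0 t0"
  \<comment> \<open>With \<open>p \<le> - (c / 2) * V\<close> the derivative of
    \<open>V powr (m - 1)\<close> is at most \<open>- (m - 1) * (c / 2) * V powr (m - 1)\<close>;
    the factor \<open>K\<close> turns this bound into minus the clock rate.\<close>
  define K where "K = 2 * m / (c * (m - 1))"
  have K: "0 < K" "K * (m - 1) * (c / 2) = m" using m c by (auto simp: K_def)
  have mono: "X t + K * V t powr (m - 1) \<le> X s + K * V s powr (m - 1)" if "s \<le> t" for t
  proof (rule DERIV_nonpos_imp_nonincreasing[OF that])
    fix u assume u: "s \<le> u"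
    then have Vu: "0 < V u" using V by (simp add: s_def)
    have "p u \<le> - (c / 2) * V u"
      using t0[of u] u Vu by (simp add: s_def field_simps)
    then have "K * ((m - 1) * V u powr (m - 1 - of_nat 1) * p u)
        \<le> K * ((m - 1) * V u powr (m - 1 - of_nat 1) * (- (c / 2) * V u))"
      using m K by (intro mult_left_mono) auto
    also have "\<dots> = - (K * (m - 1) * (c / 2)) * (V u * V u powr (m - 1 - 1))"
      by (simp add: mult_ac)
    also have "\<dots> = - (m * V u powr (m - 1))"
      unfolding K(2) using powr_mult_base[of "V u" "m - 1 - 1"] Vu by simp
    finally have "m * max 0 (V u) powr (m - 1) + K * ((m - 1) * V u powr (m - 1 - of_nat 1) * p u) \<le> 0"
      using Vu by simp
    moreover have "((\<lambda>t. X t + K * V t powr (m - 1)) has_real_derivative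
        m * max 0 (V u) powr (m - 1) + K * ((m - 1) * V u powr (m - 1 - of_nat 1) * p u)) (at u)"
      by (rule DERIV_add DERIV_cmult dX DERIV_fun_powr dV Vu)+
    ultimately show "\<exists>l. ((\<lambda>t. X t + K * V t powr (m - 1)) has_real_derivative l) (at u) \<and> l \<le> 0"
      by blast
  qed
  show thesis
  proof (rule that[of "X s + K * V s powr (m - 1)"])
    fix t :: real assume t: "0 \<le> t"
    show "X t \<le> X s + K * V s powr (m - 1)"
    proof (cases "s \<le> t")
      case True
      have "0 \<le> K * V t powr (m - 1)" using K by simp
      then show ?thesis using mono[OF True] by linarith
    next
      case False
      then have "X t \<le> X s" using X_less[of t s] V[of t] V[of s] t by (auto simp: s_def intro: less_imp_le)
      moreover have "0 \<le> K * V s powr (m - 1)" using K by simp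
      ultimately show ?thesis by linarith
    qed
  qed
qed

end

section \<open>The three kinds of profiles\<close>

context orbit begin

lemma finite_profile:
  assumes b: "0 < b" "V b = 0"
  obtains W x y where "x < y" "quasi_tw_quenching m \<mu> c x y W" "W = zero_extension W {x<..<y}"
    "(W \<longlongrightarrow> 0) (at_right x)" "(W \<longlongrightarrow> 0) (at_left y)"
    "filterlim (deriv W) at_top (at_right x)" "filterlim (deriv W) at_bot (at_left y)"
    "positive_exactly_on W {x<..<y}" "single_peak_on W {x<..<y}" "left_end_asymp m x W"
    "\<exists>A3>0. \<exists>A4>0. sim_abs W (\<lambda>\<xi>. A3 * (y - \<xi>) powr (1 / m)) (at_left y) \<and>
      sim_abs (deriv W) (\<lambda>\<xi>. - A4 * (y - \<xi>) powr (- ((m - 1) / m))) (at_left y)"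
    "\<exists>\<xi>. W \<xi> = M" "\<forall>\<xi>. W \<xi> \<le> M"
proof -
  obtain a where a: "a < 0" "V a = 0" "0 < p a" "\<And>t. a < t \<Longrightarrow> t \<le> 0 \<Longrightarrow> 0 < V t"
    using left_zero by metis
  obtain X where X: "X 0 = 0" "\<And>t. (X has_real_derivative m * max 0 (V t) powr (m - 1)) (at t)"
    using clock_exists by metis
  have Vpos: "0 < V t" if "t \<in> {a<..<b}" for t
    using a(4)[of t] V_decreasing[of t b] b that by (cases "t \<le> 0") auto
  interpret clock m \<mu> c R M V p X "{a<..<b}"
    by unfold_locales (use X a b Vpos in auto)
  have J: "J = {X a<..<X b}" by (rule J_finite[OF a(2) b(2) refl])
  have X0b: "X a < 0" "0 < X b" using T0(2) by (auto simp: J)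
  have "{a<..0} \<subseteq> {a<..<b}" "{a<..<b} \<subseteq> {a<..}" "{X a<..<0} \<subseteq> J"
    using a b X0b by (auto simp: J)
  note left = left_end[OF a(1-3) this]
  have "{0..<b} \<subseteq> {a<..<b}" "{a<..<b} \<subseteq> {..<b}" "{0<..<X b} \<subseteq> J"
    using a b X0b by (auto simp: J)
  note right = right_end[OF b this]
  have less: "X a < X b" using X0b by simp
  have "continuous_on {X a..X b} W"
  proof (rule continuous_on_IccI)
    show "(W \<longlongrightarrow> W (X a)) (at_right (X a))" "(W \<longlongrightarrow> W (X b)) (at_left (X b))"
      using left(1) right(1) W_outside[of "X a"] W_outside[of "X b"] by (simp_all add: J)
    show "W \<midarrow>x\<rightarrow> W x" if "X a < x" "x < X b" for x
      using DERIV_isCont[OF dW[of x]] that by (simp add: J isCont_def)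
  qed (rule less)
  then have "quasi_tw_quenching m \<mu> c (X a) (X b) W"
    unfolding quasi_tw_quenching_def using less quasi_tw left right by (simp add: J)
  then show thesis
    using that[of "X a" "X b" W] less zero_extension_W left right positive_exactly single_peak peak
    by (simp add: J) metis
qed

lemma half_line_clock:
  assumes pos: "\<And>t. 0 \<le> t \<Longrightarrow> 0 < V t"
  obtains a X where "clock m \<mu> c R M V p X {a<..}" "a < 0" "V a = 0" "0 < p a"
proof -
  obtain a where a: "a < 0" "V a = 0" "0 < p a" "\<And>t. a < t \<Longrightarrow> t \<le> 0 \<Longrightarrow> 0 < V t"
    using left_zero by metis
  obtain X where X: "X 0 = 0" "\<And>t. (X has_real_derivative m * max 0 (V t) powr (m - 1)) (at t)"
    using clock_exists by metis
  have Vpos: "0 < V t" if "t \<in> {a<..}" for t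
    using a(4)[of t] pos[of t] that by (cases "t \<le> 0") auto
  have "clock m \<mu> c R M V p X {a<..}"
    by unfold_locales (use X a Vpos in auto)
  then show thesis using a that by blast
qed

lemma slow_profile:
  assumes pos: "\<And>t. 0 \<le> t \<Longrightarrow> 0 < V t" and r0: "((\<lambda>t. - p t / V t) \<longlongrightarrow> 0) at_top"
  obtains W x where "quasi_tw_quenching_semi m \<mu> c x W" "W = zero_extension W {x<..}"
    "(W \<longlongrightarrow> 0) (at_right x)" "(W \<longlongrightarrow> 0) at_top" "(deriv W \<longlongrightarrow> 0) at_top"
    "filterlim (deriv W) at_top (at_right x)"
    "positive_exactly_on W {x<..}" "single_peak_on W {x<..}" "left_end_asymp m x W"
    "sim_abs W (\<lambda>\<xi>. ((m - 1) * \<mu> / c) powr (- (1 / (m - 1))) * \<xi> powr (- (1 / (m - 1)))) at_top"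
    "sim_abs (deriv W) (\<lambda>\<xi>. - inverse (m - 1) * ((m - 1) * \<mu> / c) powr (- (1 / (m - 1)))
      * \<xi> powr (- (m / (m - 1)))) at_top"
    "\<exists>\<xi>. W \<xi> = M" "\<forall>\<xi>. W \<xi> \<le> M"
proof -
  obtain a X where "clock m \<mu> c R M V p X {a<..}" and a: "a < 0" "V a = 0" "0 < p a"
    using half_line_clock[OF pos] by blast
  then interpret clock m \<mu> c R M V p X "{a<..}" by simp
  have Q': "{0..} \<subseteq> {a<..}" using a by auto
  have slow: "((\<lambda>t. p t / V t powr (2 * m - 1)) \<longlongrightarrow> - (m * \<mu> / c)) at_top"
    by (rule slow_ratio[OF pos r0])
  have "\<exists>t\<ge>0. y < X t" for y
  proof -
    have "\<forall>\<^sub>F t in at_top. y < X t"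
      using X_at_top[OF Q' slow] by (simp add: filterlim_at_top_dense)
    with eventually_ge_at_top[of 0] have "\<forall>\<^sub>F t in at_top. 0 \<le> t \<and> y < X t"
      by eventually_elim simp
    then show ?thesis by (auto simp: eventually_at_top_linorder)
  qed
  then have J: "J = {X a<..}" using J_half[OF a(2) refl] by auto
  have Xa: "X a < 0" using T0(2) by (auto simp: J)
  have "{a<..0} \<subseteq> {a<..}" "{a<..} \<subseteq> {a<..}" "{X a<..<0} \<subseteq> J" by (auto simp: J)
  note left = left_end[OF a this]
  have "{0<..} \<subseteq> J" using Xa by (auto simp: J)
  note right = slow_end[OF Q' this slow]
  have "continuous_on {X a..} W"
  proof (rule continuous_on_IciI)
    show "(W \<longlongrightarrow> W (X a)) (at_right (X a))"
      using left(1) W_outside[of "X a"] by (simp add: J)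
    show "isCont W x" if "X a < x" for x
      using DERIV_isCont[OF dW[of x]] that by (simp add: J)
  qed
  then have "quasi_tw_quenching_semi m \<mu> c (X a) W"
    unfolding quasi_tw_quenching_semi_def using quasi_tw left by (simp add: J)
  then show thesis
    using that[of "X a" W] zero_extension_W left right positive_exactly single_peak peak
    by (simp add: J) metis
qed

text \<open>The construction is the same for every \<open>m\<close>; only the slope at
  \<open>y\<close> depends on comparing \<open>m\<close> with 2, hence the three
  implications.\<close>

lemma fast_profile:
  assumes pos: "\<And>t. 0 \<le> t \<Longrightarrow> 0 < V t" and ratio: "((\<lambda>t. - p t / V t) \<longlongrightarrow> c) at_top"
  obtains W x y where "x < y" "quasi_tw_on m \<mu> c W {x<..<y}" "continuous_on {x..y} W"
    "W = zero_extension W {x<..<y}" "quenches W (at_right x)"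
    "(W \<longlongrightarrow> 0) (at_right x)" "(W \<longlongrightarrow> 0) (at_left y)"
    "filterlim (deriv W) at_top (at_right x)"
    "m < 2 \<longrightarrow> (deriv W \<longlongrightarrow> 0) (at_left y)"
    "m = 2 \<longrightarrow> (deriv W \<longlongrightarrow> - (c / 2)) (at_left y)"
    "2 < m \<longrightarrow> filterlim (deriv W) at_bot (at_left y)"
    "positive_exactly_on W {x<..<y}" "single_peak_on W {x<..<y}"
    "left_end_asymp m x W" "singular_end_asymp m y W"
proof -
  obtain a X where "clock m \<mu> c R M V p X {a<..}" and a: "a < 0" "V a = 0" "0 < p a"
    using half_line_clock[OF pos] by blast
  then interpret clock m \<mu> c R M V p X "{a<..}" by simp
  have Q': "{0..} \<subseteq> {a<..}" using a by auto
  obtain B where B: "\<And>t. 0 \<le> t \<Longrightarrow> X t \<le> B" using X_bounded[OF Q' ratio] by blast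
  \<comment> \<open>The right end is the limit of the increasing clock. It is never attained, so
    \<open>W\<close> vanishes there by definition.\<close>
  define y where "y = Sup (X ` {0..})"
  have bdd: "bdd_above (X ` {0..})" by (rule bdd_aboveI2[of _ _ B]) (use B in auto)
  have Xy: "X t < y" if "0 \<le> t" for t
  proof -
    have "X t < X (t + 1)" using X_less[of t "t + 1"] pos[of t] pos[of "t + 1"] that by simp
    also have "X (t + 1) \<le> y" unfolding y_def using that bdd by (intro cSup_upper) auto
    finally show ?thesis .
  qed
  have "(\<exists>t\<ge>0. z < X t) \<longleftrightarrow> z < y" for z
    using less_cSup_iff[OF _ bdd, of z] by (auto simp: y_def)
  then have J: "J = {X a<..<y}" using J_half[OF a(2) refl] by auto
  have Xa: "X a < 0" "0 < y" using T0(2) by (auto simp: J)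
  have "{a<..0} \<subseteq> {a<..}" "{a<..} \<subseteq> {a<..}" "{X a<..<0} \<subseteq> J" using Xa by (auto simp: J)
  note left = left_end[OF a this]
  have J0: "{0<..<y} \<subseteq> J" using Xa by (auto simp: J)
  have fast: "(W \<longlongrightarrow> 0) (at_left y)" "singular_end_asymp m y W"
    "m < 2 \<Longrightarrow> (deriv W \<longlongrightarrow> 0) (at_left y)"
    "m = 2 \<Longrightarrow> (deriv W \<longlongrightarrow> - (c / 2)) (at_left y)"
    "2 < m \<Longrightarrow> filterlim (deriv W) at_bot (at_left y)"
    using fast_end[OF Q' J0 Xa(2) Xy ratio] by auto
  have less: "X a < y" using Xa by simp
  have cont: "continuous_on {X a..y} W"
  proof (rule continuous_on_IccI)
    show "(W \<longlongrightarrow> W (X a)) (at_right (X a))" "(W \<longlongrightarrow> W y) (at_left y)"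
      using left(1) fast(1) W_outside[of "X a"] W_outside[of y] by (simp_all add: J)
    show "W \<midarrow>x\<rightarrow> W x" if "X a < x" "x < y" for x
      using DERIV_isCont[OF dW[of x]] that by (simp add: J isCont_def)
  qed (rule less)
  show thesis
  proof (rule that)
    show "W = zero_extension W {X a<..<y}" using zero_extension_W by (simp add: J)
  qed (use less cont fast left quasi_tw positive_exactly single_peak in \<open>simp_all add: J\<close>)
qed

end

text \<open>The peak height is invariant under translation, so it separates the members of a family.\<close>

lemma tw_family_by_peak:
  fixes h :: "real \<Rightarrow> real"
  assumes "inj h" and ex: "\<And>s. \<exists>W. P W \<and> (\<exists>\<xi>. W \<xi> = h s) \<and> (\<forall>\<xi>. W \<xi> \<le> h s)"
  shows "tw_family P"
proof -
  obtain W where W: "\<And>s. P (W s)" "\<And>s. \<exists>\<xi>. W s \<xi> = h s" "\<And>s \<xi>. W s \<xi> \<le> h s"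
    using ex by metis
  have "s = t" if shift: "W s = (\<lambda>\<xi>. W t (\<xi> + d))" for s t d
  proof -
    obtain u v where "W s u = h s" "W t v = h t" using W(2) by blast
    moreover have "W s u = W t (u + d)" "W s (v - d) = W t v"
      by (simp_all add: fun_cong[OF shift])
    ultimately have "h s = h t"
      using W(3)[of t "u + d"] W(3)[of s "v - d"] by simp
    then show ?thesis using assms(1) by (simp add: inj_eq)
  qed
  then show ?thesis unfolding tw_family_def using W(1) by blast
qed

section \<open>Assembly of the families and of the singular profile\<close>

theorem corollary1:
  fixes m p k \<mu> c :: real
  assumes "m > 1" and "k > 0" and "\<mu> > 0"
    and "m = 1 / (1 - p)" and "k = p * \<mu>"
    and "c > 0"
  shows
    "tw_family (\<lambda>V. \<exists>\<xi>m.
        weak_tw_quenching_semi m \<mu> c \<xi>m V \<and>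
        (V \<longlongrightarrow> 0) (at_right \<xi>m) \<and> (V \<longlongrightarrow> 0) at_top \<and> (deriv V \<longlongrightarrow> 0) at_top \<and>
        filterlim (deriv V) at_top (at_right \<xi>m) \<and>
        positive_exactly_on V {\<xi>m<..} \<and>
        single_peak_on V {\<xi>m<..} \<and>
        left_end_asymp m \<xi>m V \<and>
        sim_abs V
          (\<lambda>\<xi>. m powr (- (1 / (m - 1))) * (k / c) powr (- (1 / (m - 1)))
                * \<xi> powr (- (1 / (m - 1)))) at_top \<and>
        sim_abs (deriv V)
          (\<lambda>\<xi>. - inverse (m - 1) * m powr (- (1 / (m - 1))) * (k / c) powr (- (1 / (m - 1)))
                * \<xi> powr (- (m / (m - 1)))) at_top)
     \<and>
     tw_family (\<lambda>V. \<exists>\<xi>m \<xi>p. \<xi>m < \<xi>p \<and>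
        weak_tw_quenching m \<mu> c \<xi>m \<xi>p V \<and>
        (V \<longlongrightarrow> 0) (at_right \<xi>m) \<and> (V \<longlongrightarrow> 0) (at_left \<xi>p) \<and>
        filterlim (deriv V) at_top (at_right \<xi>m) \<and>
        filterlim (deriv V) at_bot (at_left \<xi>p) \<and>
        positive_exactly_on V {\<xi>m<..<\<xi>p} \<and>
        single_peak_on V {\<xi>m<..<\<xi>p} \<and>
        left_end_asymp m \<xi>m V \<and>
        (\<exists>A3>0. \<exists>A4>0.
           sim_abs V (\<lambda>\<xi>. A3 * (\<xi>p - \<xi>) powr (1 / m)) (at_left \<xi>p) \<and>
           sim_abs (deriv V) (\<lambda>\<xi>. - A4 * (\<xi>p - \<xi>) powr (- ((m - 1) / m))) (at_left \<xi>p)))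
     \<and>
     (m < 2 \<longrightarrow>
       (\<exists>V \<xi>m \<xi>p. \<xi>m < \<xi>p \<and>
        weak_tw_quenching_singularity (nhds 0) m \<mu> c \<xi>m \<xi>p V \<and>
        (V \<longlongrightarrow> 0) (at_right \<xi>m) \<and> (V \<longlongrightarrow> 0) (at_left \<xi>p) \<and>
        filterlim (deriv V) at_top (at_right \<xi>m) \<and>
        (deriv V \<longlongrightarrow> 0) (at_left \<xi>p) \<and>
        positive_exactly_on V {\<xi>m<..<\<xi>p} \<and>
        single_peak_on V {\<xi>m<..<\<xi>p} \<and>
        left_end_asymp m \<xi>m V \<and>
        singular_end_asymp m \<xi>p V))
     \<and>
     (m = 2 \<longrightarrow>
       (\<exists>V \<xi>m \<xi>p C. \<xi>m < \<xi>p \<and> C > 0 \<and>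
        weak_tw_quenching_singularity (nhds (- C)) m \<mu> c \<xi>m \<xi>p V \<and>
        (V \<longlongrightarrow> 0) (at_right \<xi>m) \<and> (V \<longlongrightarrow> 0) (at_left \<xi>p) \<and>
        filterlim (deriv V) at_top (at_right \<xi>m) \<and>
        (deriv V \<longlongrightarrow> - C) (at_left \<xi>p) \<and>
        positive_exactly_on V {\<xi>m<..<\<xi>p} \<and>
        single_peak_on V {\<xi>m<..<\<xi>p} \<and>
        left_end_asymp m \<xi>m V \<and>
        singular_end_asymp m \<xi>p V))
     \<and>
     (m > 2 \<longrightarrow>
       (\<exists>V \<xi>m \<xi>p. \<xi>m < \<xi>p \<and>
        weak_tw_quenching_singularity at_bot m \<mu> c \<xi>m \<xi>p V \<and>
        (V \<longlongrightarrow> 0) (at_right \<xi>m) \<and> (V \<longlongrightarrow> 0) (at_left \<xi>p) \<and>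
        filterlim (deriv V) at_top (at_right \<xi>m) \<and>
        filterlim (deriv V) at_bot (at_left \<xi>p) \<and>
        positive_exactly_on V {\<xi>m<..<\<xi>p} \<and>
        single_peak_on V {\<xi>m<..<\<xi>p} \<and>
        left_end_asymp m \<xi>m V \<and>
        singular_end_asymp m \<xi>p V))"
    (is "tw_family ?A \<and> tw_family ?B \<and> ?C1 \<and> ?C2 \<and> ?C3")
proof -
  interpret wave_params m \<mu> c using assms by unfold_locales
  \<comment> \<open>\<open>p = 1\<close> would give \<open>m = 1 / 0 = 0\<close>. Otherwise
    \<open>m * p = m - 1\<close>, which turns the constant \<open>m * (k / c)\<close> of the
    statement into \<open>(m - 1) * \<mu> / c\<close>.\<close>
  have "p \<noteq> 1" using assms(1,4) by auto
  then have "m * p = m - 1" using assms(4) by (simp add: field_simps)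
  then have mk: "m * (k / c) = (m - 1) * \<mu> / c" using assms(5) by (simp add: mult.assoc[symmetric])
  have coeff: "m powr (- (1 / (m - 1))) * (k / c) powr (- (1 / (m - 1)))
      = ((m - 1) * \<mu> / c) powr (- (1 / (m - 1)))"
    unfolding mk[symmetric] using assms by (subst powr_mult) auto
  then have coeff': "- inverse (m - 1) * m powr (- (1 / (m - 1))) * (k / c) powr (- (1 / (m - 1)))
      = - inverse (m - 1) * ((m - 1) * \<mu> / c) powr (- (1 / (m - 1)))"
    by (simp only: mult.assoc)
  obtain v0 where v0: "0 < v0"
    and small: "\<And>v. 0 \<le> v \<Longrightarrow> v \<le> v0 \<Longrightarrow> m * \<mu> * v powr (2 * m - 2) \<le> c / 2 * (c - c / 2)"
    using small_threshold by blast
  obtain M1 where M1: "0 < M1"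
    and large: "\<And>M. M1 \<le> M \<Longrightarrow>
      (2 * m - 1) * c\<^sup>2 < m * \<mu> * M powr (2 * m - 2) * (1 - exp (- ((2 * m - 1) * c)))"
    using large_threshold by blast
  have "tw_family ?A"
  proof (rule tw_family_by_peak)
    \<comment> \<open>An injection of the real line into the heights below \<open>v0\<close>; at
      rest such a peak already lies in the trapping sector.\<close>
    let ?h = "\<lambda>s. v0 / (1 + exp s)"
    have pos1: "0 < 1 + exp s" for s :: real by (simp add: add_pos_pos)
    show "inj ?h"
    proof (rule injI)
      fix s t assume "?h s = ?h t"
      then show "s = t" using v0 pos1[of s] pos1[of t] by (simp add: field_simps)
    qed
    fix s
    have hs: "0 < ?h s" "?h s \<le> v0"
      using v0 pos1[of s] by (simp_all add: field_simps)
    obtain V q where "orbit m \<mu> c (?h s) (?h s) V q" using orbit_exists[OF hs(1) order_refl] .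
    then interpret orbit m \<mu> c "?h s" "?h s" V q .
    have trapped: "0 < V t" "0 \<le> c / 2 * V t + q t" if "0 \<le> t" for t
      using trap[of "c / 2" 0 t] c hs small[of "?h s"] that by (simp_all add: V0 p0)
    have "((\<lambda>t. - q t / V t) \<longlongrightarrow> 0) at_top"
      using ratio_tendsto_0[of "c / 2" 0] trapped c by simp
    from slow_profile[OF trapped(1) this] obtain W x
      where W: "quasi_tw_quenching_semi m \<mu> c x W" "W = zero_extension W {x<..}"
        "(W \<longlongrightarrow> 0) (at_right x)" "(W \<longlongrightarrow> 0) at_top" "(deriv W \<longlongrightarrow> 0) at_top"
        "filterlim (deriv W) at_top (at_right x)"
        "positive_exactly_on W {x<..}" "single_peak_on W {x<..}" "left_end_asymp m x W"
        "sim_abs W (\<lambda>\<xi>. ((m - 1) * \<mu> / c) powr (- (1 / (m - 1))) * \<xi> powr (- (1 / (m - 1)))) at_top"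
        "sim_abs (deriv W) (\<lambda>\<xi>. - inverse (m - 1) * ((m - 1) * \<mu> / c) powr (- (1 / (m - 1)))
          * \<xi> powr (- (m / (m - 1)))) at_top"
      and peak: "\<exists>\<xi>. W \<xi> = ?h s" "\<forall>\<xi>. W \<xi> \<le> ?h s" .
    have "?A W"
      unfolding weak_tw_quenching_semi_def coeff coeff'
      by (intro exI[of _ W] conjI exI[of _ x] W)
    with peak show "\<exists>W. ?A W \<and> (\<exists>\<xi>. W \<xi> = ?h s) \<and> (\<forall>\<xi>. W \<xi> \<le> ?h s)"
      by blast
  qed
  moreover have "tw_family ?B"
  proof (rule tw_family_by_peak)
    \<comment> \<open>An injection of the real line into the heights above \<open>M1\<close>, all of
      which lead to quenching.\<close>
    let ?h = "\<lambda>s. M1 + exp s"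
    show "inj ?h" by (auto intro: injI)
    fix s
    have hs: "0 < ?h s" using M1 by (simp add: add_pos_pos)
    obtain V q where "orbit m \<mu> c (?h s) (?h s) V q" using orbit_exists[OF hs order_refl] .
    then interpret orbit m \<mu> c "?h s" "?h s" V q .
    obtain b where "0 < b" "V b = 0" using large_hits_zero[OF large[of "?h s"]] by auto
    from finite_profile[OF this] obtain W x y where W: "x < y"
        "quasi_tw_quenching m \<mu> c x y W" "W = zero_extension W {x<..<y}"
        "(W \<longlongrightarrow> 0) (at_right x)" "(W \<longlongrightarrow> 0) (at_left y)"
        "filterlim (deriv W) at_top (at_right x)" "filterlim (deriv W) at_bot (at_left y)"
        "positive_exactly_on W {x<..<y}" "single_peak_on W {x<..<y}" "left_end_asymp m x W"
        "\<exists>A3>0. \<exists>A4>0. sim_abs W (\<lambda>\<xi>. A3 * (y - \<xi>) powr (1 / m)) (at_left y) \<and>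
          sim_abs (deriv W) (\<lambda>\<xi>. - A4 * (y - \<xi>) powr (- ((m - 1) / m))) (at_left y)"
      and peak: "\<exists>\<xi>. W \<xi> = ?h s" "\<forall>\<xi>. W \<xi> \<le> ?h s" .
    have "?B W"
      unfolding weak_tw_quenching_def
      by (rule exI[of _ x], rule exI[of _ y]) (intro exI[of _ W] conjI W)
    with peak show "\<exists>W. ?B W \<and> (\<exists>\<xi>. W \<xi> = ?h s) \<and> (\<forall>\<xi>. W \<xi> \<le> ?h s)"
      by blast
  qed
  moreover obtain W x y where W: "x < y" "quasi_tw_on m \<mu> c W {x<..<y}" "continuous_on {x..y} W"
      "W = zero_extension W {x<..<y}" "quenches W (at_right x)"
      "(W \<longlongrightarrow> 0) (at_right x)" "(W \<longlongrightarrow> 0) (at_left y)"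
      "filterlim (deriv W) at_top (at_right x)"
      "positive_exactly_on W {x<..<y}" "single_peak_on W {x<..<y}"
      "left_end_asymp m x W" "singular_end_asymp m y W"
    and slope: "m < 2 \<longrightarrow> (deriv W \<longlongrightarrow> 0) (at_left y)"
      "m = 2 \<longrightarrow> (deriv W \<longlongrightarrow> - (c / 2)) (at_left y)"
      "2 < m \<longrightarrow> filterlim (deriv W) at_bot (at_left y)"
  proof -
    obtain R M V q where "orbit m \<mu> c R M V q" and pos: "\<And>t. 0 \<le> t \<Longrightarrow> 0 < V t"
      and ratio: "((\<lambda>t. - q t / V t) \<longlongrightarrow> c) at_top"
      using fast_orbit_exists by metis
    then interpret orbit m \<mu> c R M V q by simp
    show thesis
    proof (rule fast_profile[OF _ ratio])
      show "0 < V t" if "0 \<le> t" for t by (rule pos[OF that])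
    qed (rule that; assumption)
  qed
  \<comment> \<open>The filter stays open so that the same \<open>W\<close> qualifies with
    \<open>nhds 0\<close>, \<open>nhds (- (c / 2))\<close> or \<open>at_bot\<close>, according to
    \<open>m\<close>.\<close>
  have sing: "weak_tw_quenching_singularity L m \<mu> c x y W" if "filterlim (deriv W) L (at_left y)" for L
    unfolding weak_tw_quenching_singularity_def quasi_tw_quenching_singularity_def singular_end_def
    using W that by (intro exI[of _ W]) simp
  have ?C1
    by (intro impI exI[of _ W] exI[of _ x] exI[of _ y] conjI sing slope[rule_format] W)
  moreover have ?C2
    by (intro impI exI[of _ W] exI[of _ x] exI[of _ y] exI[of _ "c / 2"] conjI sing slope[rule_format] W)
      (use c in auto)
  moreover have ?C3
    by (intro impI exI[of _ W] exI[of _ x] exI[of _ y] conjI sing slope[rule_format] W)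
  ultimately show ?thesis by blast
qed

end
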